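(* Let $A$ be a unital $C^*$-algebra, let $\mathcal{H}$ be a finitely or countably generated Hilbert $A$-module, let $C\in GL(\mathcal{H})$ be adjointable, and let $\Psi=\{\psi_j\in\mathcal{H}: j\in J\}$ be a $C$-controlled frame for $\mathcal{H}$. Then $\Psi$ is a frame for $\mathcal{H}$. Furthermore, with $S$ the frame operator of $\Psi$, one has $CS=SC^*$, and so $$\sum_{j\in J}\langle f,\psi_j\rangle C\psi_j=\sum_{j\in J}\langle f,C\psi_j\rangle\psi_j\quad\text{for all } f\in\mathcal{H}.$$
   Context: Hilbert $A$-modules are left modules, with $A$-valued inner product $\langle\cdot,\cdot\rangle$ that is $A$-linear in the first variable, and norm $\|f\|=\|\langle f,f\rangle\|^{1/2}$. $J$ is a finite or countable index set. $GL(\mathcal{H})$ is the set of bounded linear operators on $\mathcal{H}$ with a bounded inverse. Given $C\in GL(\mathcal{H})$, a family $\{\psi_j\}_{j\in J}\subseteq\mathcal{H}$ is a $C$-controlled frame if there exist $m>0$ and $M<\infty$ such that $$m\langle f,f\rangle\le\sum_{j\in J}\langle f,\psi_j\rangle\langle C\psi_j,f\rangle\le M\langle f,f\rangle\quad\text{for all } f\in\mathcal{H},$$ where the sum converges in norm and the inequalities are in the order of $A$. In that case the operator $S_Cf=\sum_{j\in J}\langle f,\psi_j\rangle C\psi_j$ (which is well defined on $\mathcal{H}$) is called the $C$-controlled frame operator. A frame is a family $\{\psi_j\}$ for which there are constants $\alpha,\beta>0$ with $\alpha\langle f,f\rangle\le\sum_{j}\langle f,\psi_j\rangle\langle\psi_j,f\rangle\le\beta\langle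 f,f\rangle$ for all $f\in\mathcal{H}$; its frame operator is $Sf=\sum_{j\in J}\langle f,\psi_j\rangle\psi_j$. *)

theory Defs
  imports "HOL-Analysis.Analysis"
begin

section \<open>Unital C*-algebras\<close>

class complex_vector = real_vector +
  fixes scaleC :: "complex \<Rightarrow> 'a \<Rightarrow> 'a" (infixr "*\<^sub>C" 75)
  assumes scaleC_add_right: "c *\<^sub>C (x + y) = c *\<^sub>C x + c *\<^sub>C y"
    and scaleC_add_left: "(c + d) *\<^sub>C x = c *\<^sub>C x + d *\<^sub>C x"
    and scaleC_scaleC: "c *\<^sub>C (d *\<^sub>C x) = (c * d) *\<^sub>C x"
    and scaleC_one: "1 *\<^sub>C x = x"
    and scaleR_scaleC: "r *\<^sub>R x = complex_of_real r *\<^sub>C x"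

text \<open>
  The unit comes from the class \<^class>\<open>monoid_mult\<close>, not \<^class>\<open>real_normed_algebra_1\<close>, so that
  the zero algebra is included. Submultiplicativity of the norm is part of
  \<^class>\<open>real_normed_algebra\<close>, completeness is part of \<^class>\<open>banach\<close>.
\<close>

class unital_cstar_algebra = complex_vector + real_normed_algebra + banach + monoid_mult +
  fixes star :: "'a \<Rightarrow> 'a"
  assumes scaleC_mult_left: "(c *\<^sub>C a) * b = c *\<^sub>C (a * b)"
    and scaleC_mult_right: "a * (c *\<^sub>C b) = c *\<^sub>C (a * b)"
    and norm_scaleC: "norm (c *\<^sub>C a) = cmod c * norm a"
    and star_star: "star (star a) = a"
    and star_add: "star (a + b) = star a + star b"
    and star_scaleC: "star (c *\<^sub>C a) = cnj c *\<^sub>C star a"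
    and star_mult: "star (a * b) = star b * star a"
    and cstar_identity: "norm (star a * a) = (norm a)\<^sup>2"

definition cstar_spectrum :: "'a::unital_cstar_algebra \<Rightarrow> complex set" where
  "cstar_spectrum a =
     {c. \<not> (\<exists>b. (a - c *\<^sub>C 1) * b = 1 \<and> b * (a - c *\<^sub>C 1) = 1)}"

definition cstar_positive :: "'a::unital_cstar_algebra \<Rightarrow> bool" where
  "cstar_positive a \<longleftrightarrow>
     star a = a \<and> cstar_spectrum a \<subseteq> complex_of_real ` {0..}"

definition cstar_le :: "'a::unital_cstar_algebra \<Rightarrow> 'a \<Rightarrow> bool" (infix "\<sqsubseteq>" 50) where
  "a \<sqsubseteq> b \<longleftrightarrow> cstar_positive (b - a)"


section \<open>Hilbert modules\<close>

text \<open>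
  Left Hilbert modules: the carrier is the whole type \<open>'h\<close>, \<open>act\<close> is the action of the algebra, and
  \<open>ip\<close> is the algebra-valued inner product, linear in its first argument.
  The axiom \<open>norm_eq\<close> makes the type class norm of \<open>'h\<close>, which is complete
  by \<^class>\<open>banach\<close>, the norm induced by the inner product.
\<close>

locale hilbert_module =
  fixes act :: "'a::unital_cstar_algebra \<Rightarrow> 'h::{complex_vector,banach} \<Rightarrow> 'h"
    and ip :: "'h \<Rightarrow> 'h \<Rightarrow> 'a"
  assumes act_add_right: "act a (x + y) = act a x + act a y"
    and act_add_left: "act (a + b) x = act a x + act b x"
    and act_act: "act a (act b x) = act (a * b) x"
    and act_one: "act 1 x = x"
    and act_scaleC_left: "act (c *\<^sub>C a) x = c *\<^sub>C act a x"
    and act_scaleC_right: "act a (c *\<^sub>C x) = c *\<^sub>C act a x"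
    and ip_add_left: "ip (x + y) z = ip x z + ip y z"
    and ip_act_left: "ip (act a x) y = a * ip x y"
    and ip_star: "star (ip x y) = ip y x"
    and ip_positive: "cstar_positive (ip x x)"
    and ip_definite: "ip x x = 0 \<Longrightarrow> x = 0"
    and norm_eq: "norm x = sqrt (norm (ip x x))"

definition module_span ::
    "('a::unital_cstar_algebra \<Rightarrow> 'h::{complex_vector,banach} \<Rightarrow> 'h) \<Rightarrow> 'h set \<Rightarrow> 'h set" where
  "module_span act G = {\<Sum>g\<in>F. act (a g) g | F a. finite F \<and> F \<subseteq> G}"

definition finitely_generated ::
    "('a::unital_cstar_algebra \<Rightarrow> 'h::{complex_vector,banach} \<Rightarrow> 'h) \<Rightarrow> bool" where
  "finitely_generated act \<longleftrightarrow> (\<exists>G. finite G \<and> module_span act G = UNIV)"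

text \<open>Countable generation is topological: the span of the generators is only required to be dense.\<close>

definition countably_generated ::
    "('a::unital_cstar_algebra \<Rightarrow> 'h::{complex_vector,banach} \<Rightarrow> 'h) \<Rightarrow> bool" where
  "countably_generated act \<longleftrightarrow> (\<exists>G. countable G \<and> closure (module_span act G) = UNIV)"

text \<open>
  Linear over the algebra; complex linearity follows, since
  \<open>c *\<^sub>C x = act (c *\<^sub>C 1) x\<close>.
\<close>

definition bounded_operator ::
    "('a::unital_cstar_algebra \<Rightarrow> 'h::{complex_vector,banach} \<Rightarrow> 'h) \<Rightarrow> ('h \<Rightarrow> 'h) \<Rightarrow> bool" where
  "bounded_operator act T \<longleftrightarrow> bounded_linear T \<and> (\<forall>a x. T (act a x) = act a (T x))"

definition GL ::
    "('a::unital_cstar_algebra \<Rightarrow> 'h::{complex_vector,banach} \<Rightarrow> 'h) \<Rightarrow> ('h \<Rightarrow> 'h) set" where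
  "GL act = {T. bounded_operator act T \<and>
     (\<exists>R. bounded_operator act R \<and> R \<circ> T = id \<and> T \<circ> R = id)}"

definition is_adjoint ::
    "('h \<Rightarrow> 'h \<Rightarrow> 'a) \<Rightarrow> ('h \<Rightarrow> 'h) \<Rightarrow> ('h \<Rightarrow> 'h) \<Rightarrow> bool" where
  "is_adjoint ip T T' \<longleftrightarrow> (\<forall>x y. ip (T x) y = ip x (T' y))"

definition adjointable :: "('h \<Rightarrow> 'h \<Rightarrow> 'a) \<Rightarrow> ('h \<Rightarrow> 'h) \<Rightarrow> bool" where
  "adjointable ip T \<longleftrightarrow> (\<exists>T'. is_adjoint ip T T')"

text \<open>Meaningful for adjointable operators only; the adjoint is then unique.\<close>

definition adjoint_operator :: "('h \<Rightarrow> 'h \<Rightarrow> 'a) \<Rightarrow> ('h \<Rightarrow> 'h) \<Rightarrow> 'h \<Rightarrow> 'h" where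
  "adjoint_operator ip T = (THE T'. is_adjoint ip T T')"


section \<open>Frames\<close>

text \<open>
  Sums over the index set \<open>J\<close> are unconditional norm sums. As \<^const>\<open>infsum\<close> is
  \<open>0\<close> for families that are not summable, convergence is always stated separately.
\<close>

definition controlled_frame ::
    "('h::{complex_vector,banach} \<Rightarrow> 'h \<Rightarrow> 'a::unital_cstar_algebra) \<Rightarrow>
     ('h \<Rightarrow> 'h) \<Rightarrow> 'j set \<Rightarrow> ('j \<Rightarrow> 'h) \<Rightarrow> bool" where
  "controlled_frame ip C J \<psi> \<longleftrightarrow>
     (\<exists>m M :: real. m > 0 \<and>
        (\<forall>f. (\<lambda>j. ip f (\<psi> j) * ip (C (\<psi> j)) f) summable_on J \<and>
             m *\<^sub>R ip f f \<sqsubseteq> (\<Sum>\<^sub>\<infinity>j\<in>J. ip f (\<psi> j) * ip (C (\<psi> j)) f) \<and>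
             (\<Sum>\<^sub>\<infinity>j\<in>J. ip f (\<psi> j) * ip (C (\<psi> j)) f) \<sqsubseteq> M *\<^sub>R ip f f))"

definition frame ::
    "('h::{complex_vector,banach} \<Rightarrow> 'h \<Rightarrow> 'a::unital_cstar_algebra) \<Rightarrow>
     'j set \<Rightarrow> ('j \<Rightarrow> 'h) \<Rightarrow> bool" where
  "frame ip J \<psi> \<longleftrightarrow>
     (\<exists>\<alpha> \<beta> :: real. \<alpha> > 0 \<and> \<beta> > 0 \<and>
        (\<forall>f. (\<lambda>j. ip f (\<psi> j) * ip (\<psi> j) f) summable_on J \<and>
             \<alpha> *\<^sub>R ip f f \<sqsubseteq> (\<Sum>\<^sub>\<infinity>j\<in>J. ip f (\<psi> j) * ip (\<psi> j) f) \<and>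
             (\<Sum>\<^sub>\<infinity>j\<in>J. ip f (\<psi> j) * ip (\<psi> j) f) \<sqsubseteq> \<beta> *\<^sub>R ip f f))"

definition frame_operator ::
    "('a::unital_cstar_algebra \<Rightarrow> 'h::{complex_vector,banach} \<Rightarrow> 'h) \<Rightarrow>
     ('h \<Rightarrow> 'h \<Rightarrow> 'a) \<Rightarrow> 'j set \<Rightarrow> ('j \<Rightarrow> 'h) \<Rightarrow> 'h \<Rightarrow> 'h" where
  "frame_operator act ip J \<psi> f = (\<Sum>\<^sub>\<infinity>j\<in>J. act (ip f (\<psi> j)) (\<psi> j))"

end

theory Submission
  imports Defs
begin

text \<open>
  With \<open>Q f = \<Sum>\<^sub>j \<langle>f, \<psi>\<^sub>j\<rangle>\<langle>C \<psi>\<^sub>j, f\<rangle>\<close>, polarization shows that \<open>\<Sum>\<^sub>j \<langle>f, \<psi>\<^sub>j\<rangle>\<langle>\<psi>\<^sub>j, C\<^sup>*g\<rangle>\<close> converges for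
  all \<open>f\<close>, \<open>g\<close>, with a norm bound. Since \<open>C\<^sup>*\<close> is onto, \<open>C\<^sup>*g = f\<close> can be solved with \<open>g\<close> bounded by \<open>f\<close>,
  so the frame sum \<open>K f = \<Sum>\<^sub>j \<langle>f, \<psi>\<^sub>j\<rangle>\<langle>\<psi>\<^sub>j, f\<rangle>\<close> converges and is bounded in norm, hence in the order
  of the algebra. Positivity of the terms gives \<open>2 t Q f \<le> K f + t\<^sup>2 K (C\<^sup>*f)\<close>, hence the lower frame
  bound, and \<open>\<langle>x, x\<rangle> \<le> \<beta> \<Sum>\<^sub>F \<langle>f, \<psi>\<^sub>j\<rangle>\<langle>\<psi>\<^sub>j, f\<rangle>\<close> for finite \<open>F\<close> and \<open>x = \<Sum>\<^sub>F \<langle>f, \<psi>\<^sub>j\<rangle>\<psi>\<^sub>j\<close>, hence convergence of \<open>S f\<close>. Finally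
  \<open>\<langle>C S f, f\<rangle> = Q f\<close> is self-adjoint, so \<open>C S = S C\<^sup>*\<close> by polarization.

  The order theory of the algebra uses no Gelfand theory: positivity is characterised by
  \<open>\<parallel>t - a\<parallel> \<le> t\<close> for some \<open>t\<close>, and square roots come from the iteration \<open>w \<mapsto> (y + w\<^sup>2) / 2\<close>.
\<close>

section \<open>Elementary properties of unital C*-algebras\<close>

lemma scaleC_zero_left [simp]: "0 *\<^sub>C x = (0::'a::complex_vector)"
  by (metis of_real_0 scaleR_scaleC scaleR_zero_left)

lemma scaleC_zero_right [simp]: "c *\<^sub>C 0 = (0::'a::complex_vector)"
  by (metis add_cancel_right_right scaleC_add_right)

lemma scaleC_minus_left: "(- c) *\<^sub>C x = - (c *\<^sub>C (x::'a::complex_vector))"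
  by (metis add_eq_0_iff add.right_inverse scaleC_add_left scaleC_zero_left)

lemma scaleC_minus_right: "c *\<^sub>C (- x) = - (c *\<^sub>C (x::'a::complex_vector))"
  by (metis add_eq_0_iff add.right_inverse scaleC_add_right scaleC_zero_right)

lemma scaleC_diff_right: "c *\<^sub>C (x - y) = c *\<^sub>C x - c *\<^sub>C (y::'a::complex_vector)"
  using scaleC_add_right[of c x "- y"] by (simp add: scaleC_minus_right)

lemma scaleC_scaleR: "c *\<^sub>C (r *\<^sub>R x) = r *\<^sub>R (c *\<^sub>C (x::'a::complex_vector))"
  by (simp add: scaleR_scaleC scaleC_scaleC mult.commute)

lemma bounded_linear_scaleC: "bounded_linear (\<lambda>x::'a::unital_cstar_algebra. c *\<^sub>C x)"
  by (rule bounded_linear_intro[of _ "cmod c"])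
     (simp_all add: scaleC_add_right scaleC_scaleR norm_scaleC)

text \<open>The C*-identity leaves only 0 and 1 as values; the norm is 0 in the zero algebra, hence
  an inequality.\<close>

lemma norm_one_le: "norm (1::'a::unital_cstar_algebra) \<le> 1"
proof -
  have "star (1::'a) = 1"
    by (metis star_mult star_star mult_1_left)
  then have "norm (1::'a) = norm (1::'a) ^ 2"
    using cstar_identity[of "1::'a"] by simp
  then show ?thesis
    by (auto simp: power2_eq_square)
qed

lemma norm_scaleR_one_le: "0 \<le> r \<Longrightarrow> norm (r *\<^sub>R (1::'a::unital_cstar_algebra)) \<le> r"
  using mult_left_mono[OF norm_one_le, of r] by simp

lemma star_one [simp]: "star (1::'a::unital_cstar_algebra) = 1"
  by (metis star_mult star_star mult_1_left)

lemma star_scaleR: "star (r *\<^sub>R a) = r *\<^sub>R star (a::'a::unital_cstar_algebra)"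
  by (simp add: scaleR_scaleC star_scaleC)

lemma star_zero [simp]: "star (0::'a::unital_cstar_algebra) = 0"
  using star_scaleR[of 0 "0::'a"] by simp

lemma star_minus: "star (- a) = - star (a::'a::unital_cstar_algebra)"
  using star_scaleR[of "-1" a] by simp

lemma star_diff: "star (a - b) = star a - star (b::'a::unital_cstar_algebra)"
  using star_add[of a "- b"] by (simp add: star_minus)

lemma star_sum: "star (sum f F) = (\<Sum>j\<in>F. star (f j :: 'a::unital_cstar_algebra))"
  by (induction F rule: infinite_finite_induct) (auto simp: star_add)

lemma norm_star [simp]: "norm (star a) = norm (a::'a::unital_cstar_algebra)"
proof -
  have le: "norm b \<le> norm (star b)" for b :: 'a
  proof (cases "b = 0")
    case False
    have "norm b ^ 2 \<le> norm (star b) * norm b"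
      using norm_mult_ineq[of "star b" b] by (simp add: cstar_identity)
    then show ?thesis using False by (simp add: power2_eq_square)
  qed simp
  show ?thesis using le[of a] le[of "star a"] by (simp add: star_star)
qed

lemma bounded_linear_star: "bounded_linear (star :: 'a::unital_cstar_algebra \<Rightarrow> 'a)"
  by (rule bounded_linear_intro[of _ 1]) (simp_all add: star_add star_scaleR)

lemma norm_mult_star: "norm (a * star a) = (norm (a::'a::unital_cstar_algebra))\<^sup>2"
  using cstar_identity[of "star a"] by (simp add: star_star)

section \<open>Invertible elements and the spectrum\<close>

definition unit_elem :: "'a::monoid_mult \<Rightarrow> bool" where
  "unit_elem a \<longleftrightarrow> (\<exists>b. a * b = 1 \<and> b * a = 1)"

lemma unit_elemI:
  fixes a :: "'a::monoid_mult"
  assumes "l * a = 1" "a * r = 1"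
  shows "unit_elem a"
proof -
  have "l = r" by (metis assms mult.assoc mult_1_left mult_1_right)
  then show ?thesis using assms unit_elem_def by blast
qed

text \<open>If \<open>c\<close> inverts \<open>a * b\<close>, then \<open>c * b\<close> is a left
  inverse and \<open>b * c\<close> a right inverse of \<open>a\<close>.\<close>

lemma unit_elem_factor:
  fixes a b :: "'a::monoid_mult"
  assumes "a * b = b * a" "unit_elem (a * b)"
  shows "unit_elem a"
proof -
  from assms(2) obtain c where c: "a * b * c = 1" "c * (a * b) = 1" by (auto simp: unit_elem_def)
  show ?thesis
    by (rule unit_elemI[of "c * b" _ "b * c"]) (use c assms(1) in \<open>simp_all flip: mult.assoc\<close>)
qed

lemma unit_elem_scaleC:
  fixes a :: "'a::unital_cstar_algebra"
  assumes "c \<noteq> 0"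
  shows "unit_elem (c *\<^sub>C a) \<longleftrightarrow> unit_elem a"
proof -
  have *: "unit_elem (c *\<^sub>C a)" if "unit_elem a" "c \<noteq> 0" for c and a :: 'a
  proof -
    obtain b where "a * b = 1" "b * a = 1" using \<open>unit_elem a\<close> by (auto simp: unit_elem_def)
    then show ?thesis
      using \<open>c \<noteq> 0\<close> unfolding unit_elem_def
      by (intro exI[of _ "(1/c) *\<^sub>C b"])
         (simp add: scaleC_mult_left scaleC_mult_right scaleC_scaleC scaleC_one)
  qed
  show ?thesis
    using *[of a c] *[of "c *\<^sub>C a" "1/c"] assms by (auto simp: scaleC_scaleC scaleC_one)
qed

text \<open>Instead of a Neumann series, the one-sided inverses are the fixed points of the
  contractions sending \<open>z\<close> to \<open>1 + x * z\<close> and to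
  \<open>1 + z * x\<close>.\<close>

lemma unit_elem_one_minus:
  fixes x :: "'a::unital_cstar_algebra"
  assumes "norm x < 1"
  shows "unit_elem (1 - x)"
proof -
  have "\<exists>!z. 1 + x * z = z"
    by (rule banach_fix_type[of "norm x"])
       (use assms norm_mult_ineq[of x] in \<open>auto simp: dist_norm simp flip: right_diff_distrib\<close>)
  moreover have "\<exists>!z. 1 + z * x = z"
    by (rule banach_fix_type[of "norm x"])
       (use assms norm_mult_ineq[of _ x] in \<open>auto simp: dist_norm mult.commute[of "norm x"] simp flip: left_diff_distrib\<close>)
  ultimately obtain r l where "1 + x * r = r" "1 + l * x = l" by blast
  then have "(1 - x) * r = 1" "l * (1 - x) = 1"
    by (simp_all add: algebra_simps)
  then show ?thesis by (rule unit_elemI[rotated])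
qed

lemma cstar_spectrum_iff: "c \<in> cstar_spectrum a \<longleftrightarrow> \<not> unit_elem (a - c *\<^sub>C 1)"
  by (simp add: cstar_spectrum_def unit_elem_def)

lemma cstar_spectrum_norm:
  fixes a :: "'a::unital_cstar_algebra"
  assumes "c \<in> cstar_spectrum a"
  shows "cmod c \<le> norm a"
proof (rule ccontr)
  assume "\<not> ?thesis"
  then have c: "norm a < cmod c" by simp
  then have "c \<noteq> 0" by auto
  have "norm ((1/c) *\<^sub>C a) < 1"
    using c \<open>c \<noteq> 0\<close> by (simp add: norm_scaleC norm_divide field_simps)
  then have "unit_elem ((- c) *\<^sub>C (1 - (1/c) *\<^sub>C a))"
    using \<open>c \<noteq> 0\<close> unit_elem_scaleC unit_elem_one_minus by (metis neg_equal_0_iff_equal)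
  also have "(- c) *\<^sub>C (1 - (1/c) *\<^sub>C a) = a - c *\<^sub>C 1"
    using \<open>c \<noteq> 0\<close> by (simp add: scaleC_diff_right scaleC_minus_left scaleC_scaleC scaleC_one)
  finally show False using assms by (simp add: cstar_spectrum_iff)
qed

lemma cstar_spectrum_shift:
  fixes a :: "'a::unital_cstar_algebra"
  shows "c + d \<in> cstar_spectrum (a + d *\<^sub>C 1) \<longleftrightarrow> c \<in> cstar_spectrum a"
  by (simp add: cstar_spectrum_iff scaleC_add_left)

lemma cstar_spectrum_uminus:
  fixes a :: "'a::unital_cstar_algebra"
  shows "- c \<in> cstar_spectrum (- a) \<longleftrightarrow> c \<in> cstar_spectrum a"
proof -
  have "(- a) - (- c) *\<^sub>C 1 = (- 1) *\<^sub>C (a - c *\<^sub>C 1)"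
    by (simp add: scaleC_minus_left scaleC_one)
  then show ?thesis
    unfolding cstar_spectrum_iff by (simp add: unit_elem_scaleC)
qed

text \<open>Arens' trick: compare the spectral point and the norm of \<open>a + i\<lambda>\<close> for large real \<open>\<lambda>\<close>.\<close>

lemma cstar_spectrum_real:
  fixes a :: "'a::unital_cstar_algebra"
  assumes "star a = a" "c \<in> cstar_spectrum a"
  shows "Im c = 0"
proof -
  have *: "2 * Im c * s \<le> (norm a)\<^sup>2" for s :: real
  proof -
    define d where "d = complex_of_real s * \<i>"
    have "c + d \<in> cstar_spectrum (a + d *\<^sub>C 1)"
      using assms(2) by (simp add: cstar_spectrum_shift)
    then have "(cmod (c + d))\<^sup>2 \<le> (norm (a + d *\<^sub>C 1))\<^sup>2"
      by (intro power_mono cstar_spectrum_norm) auto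
    also have "\<dots> = norm (star (a + d *\<^sub>C 1) * (a + d *\<^sub>C 1))"
      by (simp add: cstar_identity)
    also have "star (a + d *\<^sub>C 1) * (a + d *\<^sub>C 1) = a * a + s\<^sup>2 *\<^sub>R 1"
      by (simp add: d_def star_add star_scaleC assms(1) algebra_simps scaleC_mult_left
          scaleC_mult_right scaleC_scaleC scaleC_minus_left scaleR_scaleC power2_eq_square scaleC_diff_right)
    also have "norm \<dots> \<le> (norm a)\<^sup>2 + s\<^sup>2"
      using norm_scaleR_one_le[of "s\<^sup>2", where 'a='a] norm_mult_ineq[of a a]
        norm_triangle_ineq[of "a * a" "s\<^sup>2 *\<^sub>R 1"] by (simp add: power2_eq_square)
    finally have "(cmod (c + d))\<^sup>2 \<le> (norm a)\<^sup>2 + s\<^sup>2" .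
    \<comment> \<open>The terms \<open>s\<^sup>2\<close> cancel, so \<open>2 * Im c * s\<close> is
      bounded for all real \<open>s\<close>.\<close>
    moreover have "(cmod (c + d))\<^sup>2 = (Re c)\<^sup>2 + (Im c)\<^sup>2 + 2 * Im c * s + s\<^sup>2"
      by (simp only: d_def cmod_power2) (simp add: power2_eq_square algebra_simps)
    moreover have "0 \<le> (Re c)\<^sup>2 + (Im c)\<^sup>2" by simp
    ultimately show ?thesis by linarith
  qed
  show ?thesis
  proof (rule ccontr)
    assume "Im c \<noteq> 0"
    then have "2 * Im c * (((norm a)\<^sup>2 + 1) / (2 * Im c)) = (norm a)\<^sup>2 + 1" by simp
    then show False using *[of "((norm a)\<^sup>2 + 1) / (2 * Im c)"] by linarith
  qed
qed

section \<open>Positive elements\<close>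

text \<open>With this form of positivity, closure under sums is the triangle inequality. It agrees
  with the spectral definition by \<open>cstar_positive_iff_norm_pos\<close>.\<close>

definition norm_pos :: "'a::unital_cstar_algebra \<Rightarrow> bool" where
  "norm_pos a \<longleftrightarrow> star a = a \<and> (\<exists>t. norm (t *\<^sub>R 1 - a) \<le> t)"

lemma norm_shift_mono:
  fixes a :: "'a::unital_cstar_algebra"
  assumes "norm (t *\<^sub>R 1 - a) \<le> t" "t \<le> s"
  shows "norm (s *\<^sub>R 1 - a) \<le> s"
proof -
  have "s *\<^sub>R 1 - a = (s - t) *\<^sub>R 1 + (t *\<^sub>R 1 - a)" by (simp add: scaleR_diff_left)
  then have "norm (s *\<^sub>R 1 - a) \<le> norm ((s - t) *\<^sub>R (1::'a)) + norm (t *\<^sub>R 1 - a)"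
    by (metis norm_triangle_ineq)
  then show ?thesis using assms norm_scaleR_one_le[of "s - t", where 'a='a] by linarith
qed

lemma norm_pos_star: "norm_pos a \<Longrightarrow> star a = a"
  by (simp add: norm_pos_def)

lemma norm_pos_add:
  assumes "norm_pos a" "norm_pos b" shows "norm_pos (a + b)"
proof -
  obtain s t where "norm (s *\<^sub>R 1 - a) \<le> s" "norm (t *\<^sub>R 1 - b) \<le> t"
    using assms by (auto simp: norm_pos_def)
  moreover have "(s + t) *\<^sub>R 1 - (a + b) = (s *\<^sub>R 1 - a) + (t *\<^sub>R 1 - b)"
    by (simp add: algebra_simps)
  ultimately have "norm ((s + t) *\<^sub>R 1 - (a + b)) \<le> s + t"
    by (metis add_mono norm_triangle_ineq order_trans)
  then show ?thesis using assms by (auto simp: norm_pos_def star_add)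
qed

lemma norm_pos_scaleR:
  assumes "norm_pos a" "0 \<le> r" shows "norm_pos (r *\<^sub>R a)"
proof -
  obtain s where "norm (s *\<^sub>R 1 - a) \<le> s"
    using assms by (auto simp: norm_pos_def)
  then have "norm (r *\<^sub>R (s *\<^sub>R 1 - a)) \<le> r * s"
    using \<open>0 \<le> r\<close> by (simp add: mult_left_mono)
  then have "norm ((r * s) *\<^sub>R 1 - r *\<^sub>R a) \<le> r * s"
    by (simp add: scaleR_diff_right)
  then show ?thesis using assms by (auto simp: norm_pos_def star_scaleR)
qed

lemma norm_pos_norm_minus: "star a = a \<Longrightarrow> norm_pos (norm a *\<^sub>R 1 - a)"
  by (auto simp: norm_pos_def star_diff star_scaleR intro!: exI[of _ "norm a"])

lemma norm_pos_norm_plus: "star a = a \<Longrightarrow> norm_pos (norm a *\<^sub>R 1 + a)"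
  using norm_pos_norm_minus[of "- a"] by (simp add: star_minus)

lemma norm_pos_zero: "norm_pos 0"
  by (auto simp: norm_pos_def intro!: exI[of _ 0])

lemma norm_pos_one: "norm_pos 1"
  by (auto simp: norm_pos_def intro!: exI[of _ 1])

lemma norm_pos_scaleR_one: "0 \<le> r \<Longrightarrow> norm_pos (r *\<^sub>R 1)"
  by (simp add: norm_pos_one norm_pos_scaleR)

section \<open>Square roots by iteration\<close>

fun sqrt_iter :: "'a::real_normed_algebra \<Rightarrow> nat \<Rightarrow> 'a" where
  "sqrt_iter y 0 = 0"
| "sqrt_iter y (Suc n) = (1/2) *\<^sub>R (y + sqrt_iter y n * sqrt_iter y n)"

lemma sqrt_iter_commute: "z * y = y * z \<Longrightarrow> z * sqrt_iter y n = sqrt_iter y n * z"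
proof (induction n)
  case (Suc n)
  have "z * (sqrt_iter y n * sqrt_iter y n) = sqrt_iter y n * sqrt_iter y n * z"
    by (metis Suc.IH Suc.prems mult.assoc)
  then show ?case using Suc.prems by (simp add: algebra_simps)
qed simp

lemma sqrt_iter_scalar: "0 \<le> sqrt_iter (1::real) n" "sqrt_iter (1::real) n \<le> 1"
proof -
  have "0 \<le> sqrt_iter (1::real) n \<and> sqrt_iter (1::real) n \<le> 1"
  proof (induction n)
    case (Suc n)
    then have "sqrt_iter (1::real) n * sqrt_iter 1 n \<le> 1 * 1" by (intro mult_mono) auto
    with Suc show ?case by simp
  qed simp
  then show "0 \<le> sqrt_iter (1::real) n" "sqrt_iter (1::real) n \<le> 1" by auto
qed

lemma sqrt_iter_norm:
  assumes "norm y \<le> 1"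
  shows "norm (sqrt_iter y n) \<le> sqrt_iter 1 n"
proof (induction n)
  case (Suc n)
  have "norm (sqrt_iter y n * sqrt_iter y n) \<le> sqrt_iter 1 n * sqrt_iter 1 n"
    by (rule order_trans[OF norm_mult_ineq]) (intro mult_mono Suc sqrt_iter_scalar norm_ge_zero)
  then show ?case
    using norm_triangle_ineq[of y "sqrt_iter y n * sqrt_iter y n"] assms by simp
qed simp

text \<open>The scalar iteration started from \<open>y = 1\<close> is a majorant. All iterates
  commute, so a difference of squares factors and the induction hypothesis applies to one factor,
  \<open>sqrt_iter_norm\<close> to the other.\<close>

lemma sqrt_iter_step:
  assumes "norm y \<le> 1"
  shows "norm (sqrt_iter y (Suc n) - sqrt_iter y n) \<le> sqrt_iter 1 (Suc n) - sqrt_iter 1 n"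
proof (induction n)
  case 0
  then show ?case using assms by simp
next
  case (Suc n)
  let ?w = "sqrt_iter y" and ?t = "sqrt_iter (1::real)"
  have comm: "?w n * ?w (Suc n) = ?w (Suc n) * ?w n"
    by (intro sqrt_iter_commute sqrt_iter_commute[symmetric] refl)
  have "?w (Suc (Suc n)) - ?w (Suc n) = (1/2) *\<^sub>R ((?w (Suc n) - ?w n) * (?w (Suc n) + ?w n))"
    using comm by (subst sqrt_iter.simps(2), subst (3) sqrt_iter.simps(2))
      (simp only: algebra_simps)
  also have "norm \<dots> \<le> (1/2) * (norm (?w (Suc n) - ?w n) * norm (?w (Suc n) + ?w n))"
    using norm_mult_ineq[of "?w (Suc n) - ?w n" "?w (Suc n) + ?w n"] by simp
  also have "norm (?w (Suc n) - ?w n) * norm (?w (Suc n) + ?w n) \<le> (?t (Suc n) - ?t n) * (?t (Suc n) + ?t n)"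
  proof (intro mult_mono Suc)
    show "norm (?w (Suc n) + ?w n) \<le> ?t (Suc n) + ?t n"
      using norm_triangle_ineq[of "?w (Suc n)" "?w n"] sqrt_iter_norm[OF assms, of n]
        sqrt_iter_norm[OF assms, of "Suc n"] by linarith
    show "0 \<le> ?t (Suc n) - ?t n" using Suc norm_ge_zero order_trans by blast
  qed simp
  also have "(1/2) * ((?t (Suc n) - ?t n) * (?t (Suc n) + ?t n)) = ?t (Suc (Suc n)) - ?t (Suc n)"
    using sqrt_iter.simps(2)[of "1::real" n] sqrt_iter.simps(2)[of "1::real" "Suc n"]
    by (simp only: real_scaleR_def) (simp add: field_simps)
  finally show ?case by simp
qed

text \<open>The scalar majorant is increasing and bounded by 1, so its increments are summable;
  comparison gives absolute convergence of the telescoping series.\<close>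

lemma sqrt_iter_convergent:
  fixes y :: "'a::{real_normed_algebra,banach}"
  assumes "norm y \<le> 1"
  shows "convergent (sqrt_iter y)"
proof -
  have "incseq (sqrt_iter (1::real))"
    by (rule incseq_SucI)
       (use order_trans[OF norm_ge_zero sqrt_iter_step[of "1::real"]] in simp)
  then have "convergent (sqrt_iter (1::real))"
    using incseq_convergent sqrt_iter_scalar(2) convergent_def by metis
  then have "summable (\<lambda>n. sqrt_iter (1::real) (Suc n) - sqrt_iter 1 n)"
    using telescope_summable convergent_def by blast
  then have "summable (\<lambda>n. sqrt_iter y (Suc n) - sqrt_iter y n)"
    by (rule summable_comparison_test'[where N=0]) (use sqrt_iter_step[OF assms] in auto)
  then have "convergent (\<lambda>n. \<Sum>i<n. sqrt_iter y (Suc i) - sqrt_iter y i)"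
    by (simp add: summable_iff_convergent)
  then show ?thesis by (simp only: sum_lessThan_telescope sqrt_iter.simps(1) diff_zero)
qed

text \<open>The limit satisfies \<open>2 w = y + w\<^sup>2\<close>, which is
  \<open>(1 - w)\<^sup>2 = 1 - y\<close>. The commutation clause is kept because roots of commuting
  elements have to commute later.\<close>

lemma one_minus_sqrt_exists:
  fixes y :: "'a::unital_cstar_algebra"
  assumes "star y = y" "norm y \<le> 1"
  obtains w where "star w = w" "norm w \<le> 1" "(1 - w) * (1 - w) = 1 - y"
    "\<And>z. z * y = y * z \<Longrightarrow> z * w = w * z"
proof -
  obtain w where w: "sqrt_iter y \<longlonglongrightarrow> w"
    using sqrt_iter_convergent[OF assms(2)] by (auto simp: convergent_def)
  show ?thesis
  proof
    have "star (sqrt_iter y n) = sqrt_iter y n" for n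
      by (induction n) (simp_all add: star_scaleR star_add star_mult assms(1))
    then have "sqrt_iter y \<longlonglongrightarrow> star w"
      using bounded_linear.tendsto[OF bounded_linear_star w] by simp
    then show "star w = w" using w LIMSEQ_unique by blast
    have "norm (sqrt_iter y n) \<le> 1" for n
      using sqrt_iter_norm[OF assms(2), of n] sqrt_iter_scalar(2)[of n] by linarith
    then show "norm w \<le> 1" by (intro Lim_norm_ubound[OF _ w]) auto
    have "(\<lambda>n. sqrt_iter y (Suc n)) \<longlonglongrightarrow> (1/2) *\<^sub>R (y + w * w)"
      unfolding sqrt_iter.simps by (intro tendsto_intros w)
    then have "w = (1/2) *\<^sub>R (y + w * w)" using w LIMSEQ_Suc LIMSEQ_unique by blast
    then have "2 *\<^sub>R w = y + w * w"
      by (metis (no_types, opaque_lifting) scaleR_scaleR divide_self_if mult.commute scaleR_one times_divide_eq_right zero_neq_numeral mult_1_right)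
    then show "(1 - w) * (1 - w) = 1 - y" by (simp add: algebra_simps scaleR_2)
    fix z assume z: "z * y = y * z"
    have "(\<lambda>n. z * sqrt_iter y n) \<longlonglongrightarrow> z * w" by (intro tendsto_intros w)
    moreover have "(\<lambda>n. sqrt_iter y n * z) \<longlonglongrightarrow> w * z" by (intro tendsto_intros w)
    ultimately show "z * w = w * z"
      using sqrt_iter_commute[OF z] LIMSEQ_unique by auto
  qed
qed

text \<open>After rescaling, \<open>a = t (1 - y)\<close> with \<open>norm y \<le> 1\<close>, and
  the root is \<open>sqrt t *\<^sub>R (1 - w)\<close>.\<close>

lemma norm_pos_sqrt:
  fixes a :: "'a::unital_cstar_algebra"
  assumes "norm_pos a"
  obtains r where "norm_pos r" "r * r = a" "\<And>z. z * a = a * z \<Longrightarrow> z * r = r * z"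
proof -
  obtain t0 where "norm (t0 *\<^sub>R 1 - a) \<le> t0" using assms by (auto simp: norm_pos_def)
  \<comment> \<open>The summand 1 makes \<open>t\<close> strictly positive, so that division by
    \<open>t\<close> is possible.\<close>
  moreover define t where "t = t0 + 1"
  ultimately have t: "norm (t *\<^sub>R 1 - a) \<le> t" "t > 0"
    using norm_shift_mono[of t0 a t] norm_ge_zero[of "t0 *\<^sub>R 1 - a"] by (auto simp del: norm_ge_zero)
  define y where "y = (1/t) *\<^sub>R (t *\<^sub>R 1 - a)"
  have "star y = y" using assms by (simp add: y_def star_scaleR star_diff norm_pos_star)
  moreover have "norm y \<le> 1" using t by (simp add: y_def)
  ultimately obtain w where w: "star w = w" "norm w \<le> 1" "(1 - w) * (1 - w) = 1 - y"
    "\<And>z. z * y = y * z \<Longrightarrow> z * w = w * z"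
    using one_minus_sqrt_exists by blast
  have a: "a = t *\<^sub>R (1 - y)" using t by (simp add: y_def scaleR_diff_right)
  show ?thesis
  proof
    have "norm_pos (1 - w)"
      using w by (auto simp: norm_pos_def star_diff intro!: exI[of _ 1])
    then show "norm_pos (sqrt t *\<^sub>R (1 - w))" using t by (intro norm_pos_scaleR) auto
    show "sqrt t *\<^sub>R (1 - w) * sqrt t *\<^sub>R (1 - w) = a"
      using t w(3) by (simp add: a mult.assoc[symmetric])
    fix z assume "z * a = a * z"
    then have "z * y = y * z" by (simp add: y_def algebra_simps)
    then show "z * sqrt t *\<^sub>R (1 - w) = sqrt t *\<^sub>R (1 - w) * z"
      using w(4)[of z] by (simp add: algebra_simps)
  qed
qed

text \<open>With \<open>z\<^sup>2 + s\<^sup>2 = k\<^sup>2\<close> and \<open>z\<close>, \<open>s\<close> commuting, \<open>u = z + i s\<close> is \<open>k\<close> times a unitary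
  whose real and imaginary parts are \<open>z\<close> and \<open>s\<close>.\<close>

lemma norm_le_of_sum_squares:
  fixes z s :: "'a::unital_cstar_algebra"
  assumes "star z = z" "star s = s" "z * s = s * z" "z * z + s * s = (k\<^sup>2) *\<^sub>R 1" "0 \<le> k"
  shows "norm z \<le> k" "norm s \<le> k"
proof -
  define u where "u = z + \<i> *\<^sub>C s"
  have su: "star u = z - \<i> *\<^sub>C s"
    using assms by (simp add: u_def star_add star_scaleC scaleC_minus_left)
  have "star u * u = (k\<^sup>2) *\<^sub>R 1"
    using assms(3,4) unfolding su
    by (simp add: u_def algebra_simps scaleC_mult_left scaleC_mult_right scaleC_scaleC
        scaleC_minus_left scaleC_one scaleC_diff_right)
  then have "(norm u)\<^sup>2 \<le> k\<^sup>2"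
    using norm_scaleR_one_le[of "k\<^sup>2", where 'a='a] cstar_identity[of u] by simp
  then have u: "norm u \<le> k" using assms(5) power2_le_imp_le by blast
  have "norm (u + star u) \<le> 2 * k" using norm_triangle_ineq[of u "star u"] u by simp
  moreover have "u + star u = 2 *\<^sub>R z" by (simp add: su, simp add: u_def scaleR_2)
  ultimately show "norm z \<le> k" by simp
  have "norm (u - star u) \<le> 2 * k" using norm_triangle_ineq4[of u "star u"] u by simp
  moreover have "u - star u = 2 *\<^sub>R (\<i> *\<^sub>C s)" by (simp add: su, simp add: u_def scaleR_2)
  ultimately show "norm s \<le> k" by (simp add: norm_scaleC)
qed

text \<open>Let \<open>s\<close> be a self-adjoint root of \<open>k\<^sup>2 - z\<^sup>2\<close>.
  Then \<open>norm_le_of_sum_squares\<close> gives \<open>norm s \<le> k\<close>, so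
  \<open>k\<^sup>2 - z\<^sup>2\<close> has norm at most \<open>k\<^sup>2\<close>.\<close>

lemma norm_pos_square:
  fixes z :: "'a::unital_cstar_algebra"
  assumes "star z = z"
  shows "norm_pos (z * z)"
proof -
  define k where "k = norm z + 1"
  have k: "k > 0" "norm z \<le> k" by (auto simp: k_def add_nonneg_pos)
  define y where "y = (1/k\<^sup>2) *\<^sub>R (z * z)"
  have "norm (z * z) \<le> k\<^sup>2"
    unfolding power2_eq_square
    by (rule order_trans[OF norm_mult_ineq]) (use k in \<open>auto intro: mult_mono\<close>)
  then have "norm y \<le> 1" using k by (simp add: y_def)
  moreover have "star y = y" by (simp add: y_def star_scaleR star_mult assms)
  ultimately obtain w where w: "star w = w" "(1 - w) * (1 - w) = 1 - y"
    "\<And>x. x * y = y * x \<Longrightarrow> x * w = w * x"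
    using one_minus_sqrt_exists by blast
  define s where "s = k *\<^sub>R (1 - w)"
  have ss: "s * s = k\<^sup>2 *\<^sub>R 1 - z * z"
  proof -
    have "s * s = k\<^sup>2 *\<^sub>R ((1 - w) * (1 - w))" by (simp add: s_def power2_eq_square)
    then show ?thesis using k by (simp add: w(2) y_def scaleR_diff_right)
  qed
  have "z * w = w * z" by (rule w(3)) (simp add: y_def mult.assoc)
  then have "z * s = s * z" by (simp add: s_def algebra_simps)
  moreover have "star s = s" by (simp add: s_def star_scaleR star_diff w)
  ultimately have "norm s \<le> k" using norm_le_of_sum_squares(2)[of z s k] assms ss k by simp
  then have "norm (s * s) \<le> k\<^sup>2"
    unfolding power2_eq_square
    by (intro order_trans[OF norm_mult_ineq] mult_mono) (use k in auto)
  then show ?thesis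
    by (auto simp: norm_pos_def star_mult assms ss intro!: exI[of _ "k\<^sup>2"])
qed

text \<open>The square roots \<open>r\<close> and \<open>s\<close> commute by their commutation
  clauses, so the product is the square of the self-adjoint element \<open>r * s\<close>.\<close>

lemma norm_pos_mult:
  fixes a b :: "'a::unital_cstar_algebra"
  assumes "norm_pos a" "norm_pos b" "a * b = b * a"
  shows "norm_pos (a * b)"
proof -
  obtain r where r: "norm_pos r" "r * r = a" "\<And>z. z * a = a * z \<Longrightarrow> z * r = r * z"
    using norm_pos_sqrt[OF assms(1)] by blast
  obtain s where s: "norm_pos s" "s * s = b" "\<And>z. z * b = b * z \<Longrightarrow> z * s = s * z"
    using norm_pos_sqrt[OF assms(2)] by blast
  have "b * r = r * b" using r(3) assms(3) by simp
  then have rs: "r * s = s * r" using s(3) by simp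
  have "norm_pos ((r * s) * (r * s))"
    by (rule norm_pos_square) (simp add: star_mult norm_pos_star r(1) s(1) rs)
  also have "(r * s) * (r * s) = a * b"
    by (metis r(2) s(2) rs mult.assoc)
  finally show ?thesis .
qed

text \<open>For \<open>c = a - r/2\<close> the product \<open>a (r - a)\<close> is
  \<open>(r/2)\<^sup>2 - c\<^sup>2\<close>. Its square root \<open>d\<close> commutes with
  \<open>c\<close>, so \<open>norm_le_of_sum_squares\<close> bounds \<open>c\<close>.\<close>

lemma norm_pos_interval:
  fixes a :: "'a::unital_cstar_algebra"
  assumes "norm_pos a" "norm_pos (r *\<^sub>R 1 - a)" "0 \<le> r"
  shows "norm (a - (r/2) *\<^sub>R 1) \<le> r / 2"
proof -
  define c where "c = a - (r/2) *\<^sub>R 1"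
  have r: "(r/2) *\<^sub>R 1 + (r/2) *\<^sub>R 1 = r *\<^sub>R (1::'a)" by (simp flip: scaleR_add_left)
  have "norm_pos (a * (r *\<^sub>R 1 - a))"
    by (rule norm_pos_mult[OF assms(1,2)]) (simp add: algebra_simps)
  then obtain d where d: "norm_pos d" "d * d = a * (r *\<^sub>R 1 - a)"
    "\<And>z. z * (a * (r *\<^sub>R 1 - a)) = (a * (r *\<^sub>R 1 - a)) * z \<Longrightarrow> z * d = d * z"
    using norm_pos_sqrt by blast
  have "c * d = d * c" by (rule d(3)) (simp add: c_def algebra_simps)
  moreover have "c * c + d * d = ((r/2)\<^sup>2) *\<^sub>R 1"
    using r by (simp add: d(2) c_def algebra_simps power2_eq_square flip: scaleR_add_left)
  moreover have "star c = c" by (simp add: c_def star_diff star_scaleR norm_pos_star assms(1))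
  ultimately show ?thesis
    using norm_le_of_sum_squares(1)[of c d "r/2"] assms(3) d(1) by (simp add: norm_pos_star c_def)
qed

lemma norm_pos_norm_le:
  fixes a :: "'a::unital_cstar_algebra"
  assumes "norm_pos a" "norm_pos (r *\<^sub>R 1 - a)" "0 \<le> r"
  shows "norm a \<le> r"
proof -
  have "norm a \<le> norm (a - (r/2) *\<^sub>R 1) + norm ((r/2) *\<^sub>R (1::'a))"
    using norm_triangle_ineq[of "a - (r/2) *\<^sub>R 1" "(r/2) *\<^sub>R 1"] by simp
  then show ?thesis
    using norm_pos_interval[OF assms] norm_scaleR_one_le[of "r/2", where 'a='a] assms(3) by linarith
qed

lemma norm_pos_antisym:
  fixes a :: "'a::unital_cstar_algebra"
  assumes "norm_pos a" "norm_pos (- a)"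
  shows "a = 0"
  using norm_pos_norm_le[of a 0] assms by simp

text \<open>The witness in \<open>norm_pos\<close> may vary along the filter. A common one is any
  \<open>s\<close> above the norms, since a positive element of norm below \<open>s\<close> lies
  within \<open>s\<close> of \<open>s *\<^sub>R 1\<close>.\<close>

lemma norm_pos_tendsto:
  fixes f :: "'b \<Rightarrow> 'a::unital_cstar_algebra"
  assumes "\<forall>\<^sub>F x in F. norm_pos (f x)" "(f \<longlongrightarrow> a) F" "F \<noteq> bot"
  shows "norm_pos a"
proof -
  have "\<forall>\<^sub>F x in F. star (f x) = f x"
    using assms(1) by eventually_elim (rule norm_pos_star)
  then have "((\<lambda>x. f x) \<longlongrightarrow> star a) F"
    using bounded_linear.tendsto[OF bounded_linear_star assms(2)] tendsto_cong by fast
  then have "star a = a" using assms(2,3) tendsto_unique by blast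
  moreover define s where "s = norm a + 1"
  have "\<forall>\<^sub>F x in F. norm (f x) < s"
    by (rule order_tendstoD(2)[OF tendsto_norm[OF assms(2)]]) (simp add: s_def)
  with assms(1) have bound: "\<forall>\<^sub>F x in F. norm (s *\<^sub>R 1 - f x) \<le> s"
  proof eventually_elim
    case (elim x)
    have "norm_pos ((s - norm (f x)) *\<^sub>R 1 + (norm (f x) *\<^sub>R 1 - f x))"
      using elim by (intro norm_pos_add norm_pos_scaleR_one norm_pos_norm_minus) (auto simp: norm_pos_star)
    then have "norm_pos (s *\<^sub>R 1 - f x)" by (simp add: scaleR_diff_left)
    moreover have "norm_pos (s *\<^sub>R 1 - (s *\<^sub>R 1 - f x))" using elim by simp
    ultimately show ?case
      by (rule norm_pos_norm_le) (simp add: s_def)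
  qed
  have lim: "((\<lambda>x. s *\<^sub>R 1 - f x) \<longlongrightarrow> s *\<^sub>R 1 - a) F" by (intro tendsto_intros assms(2))
  have "norm (s *\<^sub>R 1 - a) \<le> s"
    by (rule Lim_norm_ubound[OF assms(3) lim bound])
  ultimately show ?thesis by (auto simp: norm_pos_def)
qed

text \<open>The inverse \<open>b\<close> is positive, being the square of \<open>b * r\<close>.
  Multiplying \<open>b \<le> k\<close> by the commuting positive \<open>a\<close> gives
  \<open>1 \<le> k a\<close>.\<close>

lemma norm_pos_unit_gap:
  fixes a :: "'a::unital_cstar_algebra"
  assumes "norm_pos a" "unit_elem a"
  obtains e where "e > 0" "norm_pos (a - e *\<^sub>R 1)"
proof -
  obtain b where b: "a * b = 1" "b * a = 1" using assms(2) by (auto simp: unit_elem_def)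
  obtain r where r: "norm_pos r" "r * r = a" "\<And>z. z * a = a * z \<Longrightarrow> z * r = r * z"
    using norm_pos_sqrt[OF assms(1)] by blast
  have br: "b * r = r * b" by (rule r(3)) (simp add: b)
  have "star b = b * a * star b" by (simp add: b)
  also have "\<dots> = b * star (b * a)"
    by (simp add: star_mult norm_pos_star assms(1) mult.assoc)
  finally have sb: "star b = b" by (simp add: b)
  have "norm_pos ((b * r) * (b * r))"
    by (rule norm_pos_square) (simp add: star_mult sb norm_pos_star r(1) br)
  also have "(b * r) * (b * r) = b" by (metis b(1) br r(2) mult.assoc mult_1_right)
  finally have "norm_pos b" .
  define k where "k = norm b + 1"
  have k: "k > 0" by (simp add: k_def add_nonneg_pos)
  have "norm_pos (k *\<^sub>R 1 - b)"
    using norm_pos_add[OF norm_pos_norm_minus[OF sb] norm_pos_one] by (simp add: k_def algebra_simps)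
  then have "norm_pos (a * (k *\<^sub>R 1 - b))"
    using norm_pos_mult[OF assms(1), of "k *\<^sub>R 1 - b"] by (simp add: right_diff_distrib left_diff_distrib b)
  then have "norm_pos ((1/k) *\<^sub>R (a * (k *\<^sub>R 1 - b)))"
    using k by (intro norm_pos_scaleR) auto
  also have "(1/k) *\<^sub>R (a * (k *\<^sub>R 1 - b)) = a - (1/k) *\<^sub>R 1"
    using k by (simp add: algebra_simps b)
  finally show ?thesis using that[of "1/k"] k by simp
qed

text \<open>The set \<open>T\<close> of shifts that make \<open>a\<close> positive is closed and has
  a least element \<open>s\<close>. If \<open>s > 0\<close>, invertibility of \<open>a + s\<close>
  leaves a gap that allows a smaller shift.\<close>

lemma norm_pos_if_units:
  fixes a :: "'a::unital_cstar_algebra"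
  assumes "star a = a" "\<And>c::real. c > 0 \<Longrightarrow> unit_elem (a + c *\<^sub>R 1)"
  shows "norm_pos a"
proof -
  define T where "T = {t. 0 \<le> t \<and> norm_pos (a + t *\<^sub>R 1)}"
  define s where "s = Inf T"
  have ne: "T \<noteq> {}"
    using norm_pos_norm_plus[OF assms(1)] by (auto simp: T_def add.commute intro!: exI[of _ "norm a"])
  have bdd: "bdd_below T" by (auto simp: T_def intro!: bdd_belowI[of _ 0])
  have "closed T"
  proof (unfold closed_sequential_limits, safe)
    fix x :: "nat \<Rightarrow> real" and l assume x: "\<forall>n. x n \<in> T" "x \<longlonglongrightarrow> l"
    have "norm_pos (a + l *\<^sub>R 1)"
      by (rule norm_pos_tendsto[of "\<lambda>n. a + x n *\<^sub>R 1" sequentially])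
         (use x in \<open>auto simp: T_def intro!: tendsto_intros\<close>)
    moreover have "0 \<le> l" using x by (intro LIMSEQ_le_const[OF x(2)]) (auto simp: T_def)
    ultimately show "l \<in> T" by (simp add: T_def)
  qed
  then have s: "s \<in> T" unfolding s_def using ne bdd closed_contains_Inf by blast
  have "s = 0"
  proof (rule ccontr)
    assume "s \<noteq> 0"
    then have "s > 0" using s by (simp add: T_def)
    then obtain e where e: "e > 0" "norm_pos (a + s *\<^sub>R 1 - e *\<^sub>R 1)"
      using norm_pos_unit_gap[of "a + s *\<^sub>R 1"] s assms(2) by (auto simp: T_def)
    \<comment> \<open>The minimum keeps \<open>s - d\<close> nonnegative, as membership in
      \<open>T\<close> demands.\<close>
    define d where "d = min e s"
    have "norm_pos ((a + s *\<^sub>R 1 - e *\<^sub>R 1) + (e - d) *\<^sub>R 1)"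
      by (intro norm_pos_add e norm_pos_scaleR_one) (simp add: d_def)
    then have "s - d \<in> T" by (simp add: T_def algebra_simps) (simp add: d_def)
    then have "s \<le> s - d" unfolding s_def using bdd by (rule cInf_lower)
    then show False using e(1) \<open>s > 0\<close> by (simp add: d_def)
  qed
  then show ?thesis using s by (simp add: T_def)
qed

text \<open>Forwards, no negative real is in the spectrum, so all shifts by \<open>c > 0\<close> are
  invertible. Backwards, the spectrum is real, and the norm bound on \<open>t - a\<close> confines
  it to points at distance at most \<open>t\<close> from \<open>t\<close>.\<close>

lemma cstar_positive_iff_norm_pos: "cstar_positive a \<longleftrightarrow> norm_pos a"
proof
  assume a: "cstar_positive a"
  show "norm_pos a"
  proof (rule norm_pos_if_units)
    show "star a = a" using a by (simp add: cstar_positive_def)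
    fix c :: real assume "c > 0"
    then have "complex_of_real (- c) \<notin> complex_of_real ` {0..}" by (auto simp del: of_real_minus)
    then have "complex_of_real (- c) \<notin> cstar_spectrum a"
      using a unfolding cstar_positive_def by blast
    then show "unit_elem (a + c *\<^sub>R 1)"
      by (simp add: cstar_spectrum_iff scaleC_minus_left scaleR_scaleC)
  qed
next
  assume a: "norm_pos a"
  then obtain t where t: "norm (t *\<^sub>R 1 - a) \<le> t" by (auto simp: norm_pos_def)
  have "c \<in> complex_of_real ` {0..}" if c: "c \<in> cstar_spectrum a" for c
  proof -
    have im: "Im c = 0" using cstar_spectrum_real[OF norm_pos_star[OF a] c] .
    have "- c + complex_of_real t \<in> cstar_spectrum (- a + complex_of_real t *\<^sub>C 1)"
      using c by (simp only: cstar_spectrum_shift cstar_spectrum_uminus)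
    then have "cmod (- c + complex_of_real t) \<le> norm (- a + complex_of_real t *\<^sub>C 1)"
      by (rule cstar_spectrum_norm)
    also have "- a + complex_of_real t *\<^sub>C 1 = t *\<^sub>R 1 - a" by (simp add: scaleR_scaleC)
    finally have "cmod (- c + complex_of_real t) \<le> t" using t by simp
    then have "\<bar>t - Re c\<bar> \<le> t"
      using abs_Re_le_cmod[of "- c + complex_of_real t"] by simp
    then have "Re c \<ge> 0" by linarith
    then show ?thesis using im by (auto intro!: image_eqI[of _ _ "Re c"] complex_eqI)
  qed
  then show "cstar_positive a" using a by (auto simp: cstar_positive_def norm_pos_star)
qed

lemma norm_pos_unit_shift:
  fixes a :: "'a::unital_cstar_algebra"
  assumes "norm_pos a" "0 < c"
  shows "unit_elem (a + c *\<^sub>R 1)"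
proof -
  have "complex_of_real (- c) \<notin> complex_of_real ` {0..}"
    using assms(2) by (auto simp del: of_real_minus)
  then have "complex_of_real (- c) \<notin> cstar_spectrum a"
    using assms(1) unfolding cstar_positive_iff_norm_pos[symmetric] cstar_positive_def by blast
  then show ?thesis by (simp add: cstar_spectrum_iff scaleC_minus_left scaleR_scaleC)
qed


lemma unit_elem_scaleR:
  fixes a :: "'a::unital_cstar_algebra"
  shows "r \<noteq> 0 \<Longrightarrow> unit_elem (r *\<^sub>R a) \<longleftrightarrow> unit_elem a"
  by (simp add: scaleR_scaleC unit_elem_scaleC)

text \<open>Jacobson's lemma: if \<open>u\<close> inverts \<open>c - y x\<close>, then
  \<open>(1 + x u y) / c\<close> inverts \<open>c - x y\<close>.\<close>

lemma unit_elem_swap: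
  fixes x y :: "'a::unital_cstar_algebra"
  assumes "unit_elem (c *\<^sub>R 1 - y * x)" "c \<noteq> 0"
  shows "unit_elem (c *\<^sub>R 1 - x * y)"
proof -
  obtain u where u: "(c *\<^sub>R 1 - y * x) * u = 1" "u * (c *\<^sub>R 1 - y * x) = 1"
    using assms(1) by (auto simp: unit_elem_def)
  define z where "z = 1 + x * u * y"
  have "(c *\<^sub>R 1 - x * y) * z = c *\<^sub>R 1 - x * y + x * ((c *\<^sub>R 1 - y * x) * u) * y"
    by (simp add: z_def algebra_simps)
  moreover have "z * (c *\<^sub>R 1 - x * y) = c *\<^sub>R 1 - x * y + x * (u * (c *\<^sub>R 1 - y * x)) * y"
    by (simp add: z_def algebra_simps)
  ultimately have "(c *\<^sub>R 1 - x * y) * z = c *\<^sub>R 1" "z * (c *\<^sub>R 1 - x * y) = c *\<^sub>R 1"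
    by (simp_all add: u)
  then show ?thesis
    using assms(2) by (intro unit_elemI[of "(1/c) *\<^sub>R z" _ "(1/c) *\<^sub>R z"]) simp_all
qed

text \<open>The Kelley--Vaught theorem: with \<open>q\<close> twice the negative part of \<open>b = a\<^sup>* a\<close> and \<open>x = a q\<close>,
  both \<open>x\<^sup>* x\<close> and, by \<open>unit_elem_swap\<close>, \<open>x x\<^sup>*\<close> are negative, although their sum is a sum
  of squares of self-adjoint elements.\<close>

lemma norm_pos_star_mult:
  fixes a :: "'a::unital_cstar_algebra"
  shows "norm_pos (star a * a)"
proof -
  define b where "b = star a * a"
  have sb: "star b = b" by (simp add: b_def star_mult star_star)
  obtain m where m: "norm_pos m" "m * m = b * b" "\<And>z. z * (b * b) = b * b * z \<Longrightarrow> z * m = m * z"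
    using norm_pos_sqrt[OF norm_pos_square[OF sb]] by blast
  have bm: "b * m = m * b" by (rule m(3)) (simp add: mult.assoc)
  define q where "q = m - b"
  have sq: "star q = q" by (simp add: q_def star_diff sb norm_pos_star m(1))
  have "norm_pos q"
  proof (rule norm_pos_if_units[OF sq])
    fix c :: real assume c: "c > 0"
    \<comment> \<open>As \<open>m\<close> and \<open>b\<close> commute and have the same square,
      \<open>q (m + b) = 0\<close>. Hence \<open>(q + c) (m + b + c) = 2 c (m + c/2)\<close>, which
      is invertible, and so is its factor \<open>q + c\<close>.\<close>
    have e: "(2 * c) *\<^sub>R (m + (c / 2) *\<^sub>R 1) = c *\<^sub>R m + c *\<^sub>R m + (c * c) *\<^sub>R (1::'a)"
      by (simp add: scaleR_add_right scaleR_scaleR[symmetric] scaleR_2[symmetric] del: scaleR_scaleR) (simp add: mult.assoc)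
    have qm: "q * (m + b) = 0" "(m + b) * q = 0"
      by (simp_all add: q_def algebra_simps m(2) bm)
    have "(q + c *\<^sub>R 1) * (m + b + c *\<^sub>R 1) = q * (m + b) + c *\<^sub>R q + c *\<^sub>R (m + b) + (c * c) *\<^sub>R 1"
      by (simp add: distrib_left distrib_right scaleR_add_right add_ac)
    then have "(q + c *\<^sub>R 1) * (m + b + c *\<^sub>R 1) = (2 * c) *\<^sub>R (m + (c / 2) *\<^sub>R 1)"
      unfolding e qm by (simp add: q_def scaleR_add_right scaleR_diff_right)
    moreover have "(m + b + c *\<^sub>R 1) * (q + c *\<^sub>R 1) = (m + b) * q + c *\<^sub>R q + c *\<^sub>R (m + b) + (c * c) *\<^sub>R 1"
      by (simp add: distrib_left distrib_right scaleR_add_right add_ac)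
    then have "(m + b + c *\<^sub>R 1) * (q + c *\<^sub>R 1) = (2 * c) *\<^sub>R (m + (c / 2) *\<^sub>R 1)"
      unfolding e qm by (simp add: q_def scaleR_add_right scaleR_diff_right)
    moreover have "unit_elem ((2 * c) *\<^sub>R (m + (c / 2) *\<^sub>R 1))"
      using c m(1) by (simp add: unit_elem_scaleR norm_pos_unit_shift)
    ultimately show "unit_elem (q + c *\<^sub>R 1)"
      using unit_elem_factor by metis
  qed
  then have q3: "norm_pos (q * (q * q))"
    by (rule norm_pos_mult) (simp_all add: norm_pos_square sq mult.assoc)
  define x where "x = a * q"
  \<comment> \<open>This turns \<open>star x * x = q b q\<close> into
    \<open>- q\<^sup>3 / 2\<close>, which is negative.\<close>
  have "2 *\<^sub>R (q * b) = - (q * q)"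
    by (simp add: q_def m(2) bm algebra_simps scaleR_2)
  then have "q * b = (1/2) *\<^sub>R (- (q * q))"
    by (metis (no_types) scaleR_half_double scaleR_2 scaleR_right_distrib)
  then have qbq: "q * b * q = (-1/2) *\<^sub>R (q * (q * q))" by (simp add: mult.assoc)
  have sxx: "star x * x = q * b * q" by (simp add: x_def star_mult sq b_def mult.assoc)
  have "norm_pos ((1/2) *\<^sub>R (q * (q * q)))" using q3 by (intro norm_pos_scaleR) auto
  then have neg1: "norm_pos (- (star x * x))" by (simp add: sxx qbq)
  have neg2: "norm_pos (- (x * star x))"
  proof (rule norm_pos_if_units)
    show "star (- (x * star x)) = - (x * star x)" by (simp add: star_minus star_mult star_star)
    fix c :: real assume c: "c > 0"
    show "unit_elem (- (x * star x) + c *\<^sub>R 1)"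
      using norm_pos_unit_shift[OF neg1 c] unit_elem_swap[of c "star x" x] c
      by (simp add: add.commute)
  qed
  \<comment> \<open>\<open>S\<close> is twice the real part of \<open>x\<close>, and
    \<open>V\<close> is minus twice its imaginary part.\<close>
  define S where "S = x + star x"
  define V where "V = \<i> *\<^sub>C (x - star x)"
  have "star S = S" "star V = V"
    by (simp_all add: S_def V_def star_add star_diff star_star star_scaleC add.commute
        scaleC_minus_left scaleC_diff_right)
  then have "norm_pos ((1/2) *\<^sub>R (S * S + V * V) + - (x * star x))"
    by (intro norm_pos_add norm_pos_scaleR norm_pos_square neg2) auto
  moreover have "S * S + V * V = 2 *\<^sub>R (star x * x + x * star x)"
    by (simp add: S_def V_def algebra_simps scaleC_mult_left scaleC_mult_right scaleC_scaleC
        scaleC_minus_left scaleC_one scaleC_diff_right scaleR_2)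
  ultimately have "norm_pos (star x * x)" by simp
  then have "star x * x = 0" using neg1 norm_pos_antisym by blast
  \<comment> \<open>From \<open>q\<^sup>3 = 0\<close> follows \<open>q\<^sup>4 = 0\<close>, and two
    uses of the C*-identity give \<open>q = 0\<close>, that is \<open>b = m\<close>.\<close>
  then have "q * (q * q) = 0" by (simp add: sxx qbq)
  then have "star (q * q) * (q * q) = 0" by (simp add: star_mult sq mult.assoc)
  then have "q * q = 0" using cstar_identity[of "q * q"] by simp
  then have "q = 0" using cstar_identity[of q] by (simp add: sq)
  then show ?thesis using m(1) by (simp add: q_def b_def)
qed

section \<open>The order of the algebra\<close>

lemma cstar_le_iff: "a \<sqsubseteq> b \<longleftrightarrow> norm_pos (b - a)"
  by (simp add: cstar_le_def cstar_positive_iff_norm_pos)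

lemma cstar_le_refl [simp]: "a \<sqsubseteq> a"
  by (simp add: cstar_le_iff norm_pos_zero)

lemma cstar_le_trans [trans]: "a \<sqsubseteq> b \<Longrightarrow> b \<sqsubseteq> c \<Longrightarrow> a \<sqsubseteq> c"
  unfolding cstar_le_iff using norm_pos_add[of "b - a" "c - b"] by simp

lemma cstar_le_add_mono: "a \<sqsubseteq> b \<Longrightarrow> c \<sqsubseteq> d \<Longrightarrow> a + c \<sqsubseteq> b + d"
  unfolding cstar_le_iff using norm_pos_add[of "b - a" "d - c"] by (simp add: algebra_simps)

lemma cstar_le_scaleR_mono: "a \<sqsubseteq> b \<Longrightarrow> 0 \<le> r \<Longrightarrow> r *\<^sub>R a \<sqsubseteq> r *\<^sub>R b"
  unfolding cstar_le_iff using norm_pos_scaleR[of "b - a" r] by (simp add: scaleR_diff_right)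

lemma cstar_le_scaleR_left_mono: "0 \<sqsubseteq> a \<Longrightarrow> r \<le> s \<Longrightarrow> r *\<^sub>R a \<sqsubseteq> s *\<^sub>R a"
  unfolding cstar_le_iff using norm_pos_scaleR[of a "s - r"] by (simp add: scaleR_diff_left)

lemma cstar_le_norm: "star a = a \<Longrightarrow> a \<sqsubseteq> norm a *\<^sub>R 1"
  by (simp add: cstar_le_iff norm_pos_norm_minus)

lemma zero_le_mult_star: "0 \<sqsubseteq> a * star a"
  using norm_pos_star_mult[of "star a"] by (simp add: cstar_le_iff star_star)

lemma zero_le_one_cstar: "0 \<sqsubseteq> 1"
  by (simp add: cstar_le_iff norm_pos_one)

lemma cstar_le_norm_mono:
  assumes "0 \<sqsubseteq> a" "a \<sqsubseteq> b" shows "norm a \<le> norm b"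
proof (rule norm_pos_norm_le)
  show "norm_pos a" using assms by (simp add: cstar_le_iff)
  have "0 \<sqsubseteq> b" using assms cstar_le_trans by blast
  then have "b \<sqsubseteq> norm b *\<^sub>R 1" by (intro cstar_le_norm) (simp add: cstar_le_iff norm_pos_star)
  with assms show "norm_pos (norm b *\<^sub>R 1 - a)"
    unfolding cstar_le_iff[symmetric] using cstar_le_trans by blast
qed simp

text \<open>With \<open>b - a = r * r\<close>, the difference of the two sides is
  \<open>(c * r) * star (c * r)\<close>.\<close>

lemma cstar_le_conj_mono:
  assumes "a \<sqsubseteq> b" shows "c * a * star c \<sqsubseteq> c * b * star c"
proof -
  obtain r where r: "norm_pos r" "r * r = b - a"
    using norm_pos_sqrt assms cstar_le_iff by metis
  have "c * b * star c - c * a * star c = c * (b - a) * star c" by (simp add: algebra_simps)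
  also have "\<dots> = (c * r) * star (c * r)" by (simp add: star_mult norm_pos_star r(1) mult.assoc flip: r(2))
  finally show ?thesis using zero_le_mult_star[of "c * r"] by (simp add: cstar_le_iff)
qed

lemma cstar_le_tendsto:
  assumes "(f \<longlongrightarrow> a) F" "(g \<longlongrightarrow> b) F" "F \<noteq> bot" "\<forall>\<^sub>F x in F. f x \<sqsubseteq> g x"
  shows "a \<sqsubseteq> b"
  unfolding cstar_le_iff
  by (rule norm_pos_tendsto[of "\<lambda>x. g x - f x" F])
     (use assms in \<open>auto simp: cstar_le_iff intro!: tendsto_intros\<close>)

lemma cstar_le_epsilon:
  assumes "\<And>e::real. e > 0 \<Longrightarrow> a \<sqsubseteq> b + e *\<^sub>R c"
  shows "a \<sqsubseteq> b"
proof (rule cstar_le_tendsto[of "\<lambda>_. a" _ sequentially])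
  have "(\<lambda>n. b + inverse (real (Suc n)) *\<^sub>R c) \<longlonglongrightarrow> b + 0 *\<^sub>R c"
    by (intro tendsto_intros LIMSEQ_inverse_real_of_nat)
  then show "(\<lambda>n. b + inverse (real (Suc n)) *\<^sub>R c) \<longlonglongrightarrow> b" by simp
qed (use assms in auto)

lemma cstar_le_sum:
  "(\<And>j. j \<in> F \<Longrightarrow> f j \<sqsubseteq> g j) \<Longrightarrow> sum f F \<sqsubseteq> sum g F"
  by (induction F rule: infinite_finite_induct) (auto intro: cstar_le_add_mono)

section \<open>Unconditional sums\<close>

lemma cstar_le_has_sum:
  assumes "(f has_sum a) J" "(g has_sum b) J" "\<And>j. j \<in> J \<Longrightarrow> f j \<sqsubseteq> g j"
  shows "a \<sqsubseteq> b"
  using assms(1,2) unfolding has_sum_def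
  by (rule cstar_le_tendsto)
     (auto simp: finite_subsets_at_top_neq_bot intro!: eventually_finite_subsets_at_top_weakI cstar_le_sum assms(3))

lemma sum_le_has_sum_cstar:
  assumes "(f has_sum a) J" "\<And>j. j \<in> J \<Longrightarrow> 0 \<sqsubseteq> f j" "finite F" "F \<subseteq> J"
  shows "sum f F \<sqsubseteq> a"
proof -
  \<comment> \<open>Extended by zero, the finite sum becomes a sum over \<open>J\<close> that can be
    compared termwise.\<close>
  have "((\<lambda>j. if j \<in> F then f j else 0) has_sum sum f F) F"
    by (rule has_sum_finiteI) (auto simp: assms intro!: sum.cong)
  then have "((\<lambda>j. if j \<in> F then f j else 0) has_sum sum f F) J"
    by (rule has_sum_cong_neutral[THEN iffD1, rotated -1]) (use assms in auto)
  then show ?thesis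
    using assms(1) by (rule cstar_le_has_sum) (use assms(2) in auto)
qed

lemma has_sum_small_tails:
  fixes f :: "'j \<Rightarrow> 'b::real_normed_vector"
  assumes "(f has_sum s) A" "0 < e"
  obtains F where "finite F" "F \<subseteq> A" "\<And>G. finite G \<Longrightarrow> G \<subseteq> A - F \<Longrightarrow> norm (sum f G) < e"
proof -
  have "\<forall>\<^sub>F F in finite_subsets_at_top A. dist (sum f F) s < e / 2"
    using assms unfolding has_sum_def by (intro tendstoD) auto
  then obtain F where "finite F \<and> F \<subseteq> A \<and> (\<forall>G. finite G \<and> F \<subseteq> G \<and> G \<subseteq> A \<longrightarrow> dist (sum f G) s < e / 2)"
    unfolding eventually_finite_subsets_at_top ..
  then have F: "finite F" "F \<subseteq> A"
    and *: "\<And>G. finite G \<Longrightarrow> F \<subseteq> G \<Longrightarrow> G \<subseteq> A \<Longrightarrow> dist (sum f G) s < e / 2"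
    by simp_all
  have "norm (sum f G) < e" if "finite G" "G \<subseteq> A - F" for G
  proof -
    have "sum f (F \<union> G) = sum f F + sum f G"
      using that F by (intro sum.union_disjoint) auto
    moreover have "dist (sum f (F \<union> G)) (sum f F) < e"
    proof (rule dist_triangle_half_l)
      show "dist (sum f (F \<union> G)) s < e / 2" by (rule *) (use that F in auto)
      show "dist (sum f F) s < e / 2" by (rule *) (use F in auto)
    qed
    ultimately show ?thesis by (simp add: dist_norm)
  qed
  with F show ?thesis using that by blast
qed

text \<open>The converse of \<open>has_sum_small_tails\<close>: all sums over finite sets containing
  \<open>F\<close> are close to the sum over \<open>F\<close>, so they form a Cauchy filter, which
  converges by completeness.\<close>

lemma summable_on_small_tails:
  fixes f :: "'j \<Rightarrow> 'b::banach"
  assumes "\<And>e. 0 < e \<Longrightarrow> \<exists>F. finite F \<and> F \<subseteq> A \<and> (\<forall>G. finite G \<longrightarrow> G \<subseteq> A - F \<longrightarrow> norm (sum f G) < e)"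
  shows "f summable_on A"
proof -
  have "\<exists>P. eventually P (finite_subsets_at_top A) \<and>
      (\<forall>F F'. P F \<and> P F' \<longrightarrow> dist (sum f F) (sum f F') < e)" if "e > 0" for e
  proof -
    have "0 < e / 2" using that by simp
    from assms[OF this] obtain F where F: "finite F" "F \<subseteq> A"
      and small: "\<And>G. finite G \<Longrightarrow> G \<subseteq> A - F \<Longrightarrow> norm (sum f G) < e / 2"
      by blast
    define P where "P G \<longleftrightarrow> finite G \<and> F \<subseteq> G \<and> G \<subseteq> A" for G
    have "eventually P (finite_subsets_at_top A)"
      unfolding eventually_finite_subsets_at_top P_def
      by (intro exI[of _ F] conjI allI impI F) auto
    moreover have near: "dist (sum f G) (sum f F) < e / 2" if "P G" for G
    proof -
      have "norm (sum f (G - F)) < e / 2" by (rule small) (use that in \<open>auto simp: P_def\<close>)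
      then show ?thesis using that by (simp add: P_def dist_norm sum_diff F)
    qed
    ultimately show ?thesis
      by (intro exI[of _ P] conjI allI impI) (auto intro: dist_triangle_half_l[OF near near])
  qed
  then have "cauchy_filter (filtermap (sum f) (finite_subsets_at_top A))"
    by (simp add: cauchy_filter_metric_filtermap)
  then obtain l where "(sum f \<longlongrightarrow> l) (finite_subsets_at_top A)"
    using complete_uniform[where S="UNIV::'b set"] by (force simp add: filterlim_def complete_UNIV)
  then show ?thesis
    using summable_on_def has_sum_def by blast
qed

lemma star_inverse_selfadjoint:
  fixes a b :: "'a::unital_cstar_algebra"
  assumes "a * b = 1" "b * a = 1" "star a = a"
  shows "star b = b"
proof -
  have "star b = b * (a * star b)" by (simp add: assms flip: mult.assoc)
  also have "a * star b = star (b * a)" by (simp add: star_mult assms(3))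
  finally show ?thesis by (simp add: assms)
qed

section \<open>Operators on Hilbert modules\<close>

context hilbert_module
begin

section \<open>Inner product calculus, Cauchy-Schwarz and order bounds\<close>

lemma ip_add_right: "ip x (y + z) = ip x y + ip x z"
  by (metis ip_add_left ip_star star_add)

lemma ip_act_right: "ip x (act a y) = ip x y * star a"
  by (metis ip_act_left ip_star star_mult)

lemma act_scaleC_one: "act (c *\<^sub>C 1) x = c *\<^sub>C x"
  by (simp add: act_scaleC_left act_one)

lemma ip_scaleC_left: "ip (c *\<^sub>C x) y = c *\<^sub>C ip x y"
  using ip_act_left[of "c *\<^sub>C 1" x y] by (simp add: act_scaleC_one scaleC_mult_left)

lemma ip_scaleC_right: "ip x (c *\<^sub>C y) = cnj c *\<^sub>C ip x y"
  by (metis ip_scaleC_left ip_star star_scaleC)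

lemma ip_scaleR_left: "ip (r *\<^sub>R x) y = r *\<^sub>R ip x y"
  by (simp add: scaleR_scaleC ip_scaleC_left)

lemma ip_scaleR_right: "ip x (r *\<^sub>R y) = r *\<^sub>R ip x y"
  by (simp add: scaleR_scaleC ip_scaleC_right)

lemma ip_zero_left [simp]: "ip 0 x = 0"
  using ip_scaleR_left[of 0 0 x] by simp

lemma ip_zero_right [simp]: "ip x 0 = 0"
  using ip_scaleR_right[of x 0 0] by simp

lemma ip_diff_left: "ip (x - y) z = ip x z - ip y z"
  using ip_add_left[of "x - y" y z] by simp

lemma ip_diff_right: "ip x (y - z) = ip x y - ip x z"
  using ip_add_right[of x "y - z" z] by simp

lemma ip_sum_left: "ip (sum f F) y = (\<Sum>j\<in>F. ip (f j) y)"
  by (induction F rule: infinite_finite_induct) (simp_all add: ip_add_left)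

lemma ip_ge_zero: "0 \<sqsubseteq> ip x x"
  by (simp add: cstar_le_def ip_positive)

lemma norm_ip_self: "norm (ip x x) = (norm x)\<^sup>2"
  by (simp add: norm_eq)

lemma ip_self_le: "ip x x \<sqsubseteq> (norm x)\<^sup>2 *\<^sub>R 1"
  using cstar_le_norm[OF ip_star[of x x]] by (simp add: norm_ip_self)

text \<open>The norm of \<open>'h\<close> is real homogeneous by its type class; complex homogeneity
  comes from the inner product.\<close>

lemma norm_scaleC_module: "norm (c *\<^sub>C x :: 'h) = cmod c * norm x"
proof -
  have "(norm (c *\<^sub>C x))\<^sup>2 = (cmod c * norm x)\<^sup>2"
    unfolding power_mult_distrib norm_ip_self[symmetric]
    by (simp add: ip_scaleC_left ip_scaleC_right norm_scaleC power2_eq_square)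
  then show ?thesis by (simp add: power2_eq_iff_nonneg)
qed

text \<open>Expand the positive element \<open>ip z z\<close> at
  \<open>z = x - act (t *\<^sub>R a) y\<close>, where \<open>a = ip x y\<close>, and bound
  \<open>ip y y\<close> by \<open>1/t\<close>, the squared norm of \<open>y\<close>.\<close>

lemma Cauchy_Schwarz_cstar: "ip x y * star (ip x y) \<sqsubseteq> (norm y)\<^sup>2 *\<^sub>R ip x x"
proof (cases "y = 0")
  case False
  define a where "a = ip x y"
  define n where "n = (norm y)\<^sup>2"
  define t where "t = 1 / n"
  have n: "n > 0" using False by (simp add: n_def)
  have "ip y x = star a" by (simp add: a_def ip_star)
  then have z: "ip (x - act (t *\<^sub>R a) y) (x - act (t *\<^sub>R a) y)
      = ip x x - 2 *\<^sub>R t *\<^sub>R (a * star a) + t\<^sup>2 *\<^sub>R (a * ip y y * star a)"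
    unfolding scaleR_2
    by (simp add: ip_diff_left ip_diff_right ip_act_left ip_act_right star_scaleR
        power2_eq_square mult.assoc left_diff_distrib scaleR_diff_right flip: a_def)
  have "a * ip y y * star a \<sqsubseteq> a * (n *\<^sub>R 1) * star a"
    using cstar_le_conj_mono[OF ip_self_le] by (simp add: n_def)
  then have "t\<^sup>2 *\<^sub>R (a * ip y y * star a) \<sqsubseteq> t\<^sup>2 *\<^sub>R (n *\<^sub>R (a * star a))"
    by (intro cstar_le_scaleR_mono) auto
  also have "t\<^sup>2 *\<^sub>R (n *\<^sub>R (a * star a)) = t *\<^sub>R (a * star a)"
    using n by (simp add: t_def power2_eq_square)
  finally have "ip (x - act (t *\<^sub>R a) y) (x - act (t *\<^sub>R a) y)
      \<sqsubseteq> ip x x - 2 *\<^sub>R t *\<^sub>R (a * star a) + t *\<^sub>R (a * star a)"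
    unfolding z by (intro cstar_le_add_mono cstar_le_refl)
  then have "0 \<sqsubseteq> ip x x - 2 *\<^sub>R t *\<^sub>R (a * star a) + t *\<^sub>R (a * star a)"
    using ip_ge_zero cstar_le_trans by blast
  then have "t *\<^sub>R (a * star a) \<sqsubseteq> ip x x"
    by (simp only: cstar_le_iff scaleR_2) (simp add: algebra_simps)
  then have "n *\<^sub>R t *\<^sub>R (a * star a) \<sqsubseteq> n *\<^sub>R ip x x"
    using n by (intro cstar_le_scaleR_mono) auto
  then show ?thesis using n by (simp add: t_def a_def n_def)
qed simp

lemma norm_ip_le: "norm (ip x y) \<le> norm x * norm y"
proof -
  have "norm (ip x y * star (ip x y)) \<le> norm ((norm y)\<^sup>2 *\<^sub>R ip x x)"
    by (intro cstar_le_norm_mono zero_le_mult_star Cauchy_Schwarz_cstar)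
  then have "(norm (ip x y))\<^sup>2 \<le> (norm x * norm y)\<^sup>2"
    by (simp add: norm_mult_star norm_ip_self power_mult_distrib mult.commute)
  then show ?thesis by (rule power2_le_imp_le) simp
qed

lemma bounded_linear_ip_left: "bounded_linear (\<lambda>x. ip x y)"
  by (rule bounded_linear_intro[of _ "norm y"]) (simp_all add: ip_add_left ip_scaleR_left norm_ip_le)

text \<open>Apply the norm bound to \<open>(\<langle>f, f\<rangle> + \<epsilon>)\<^sup>-\<^sup>1\<^sup>/\<^sup>2 f\<close>, which lies in the unit ball.\<close>

lemma norm_bound_imp_order_bound:
  fixes K :: "'h \<Rightarrow> 'a"
  assumes "\<And>f. star (K f) = K f" "\<And>a f. K (act a f) = a * K f * star a"
    and bound: "\<And>f. norm (K f) \<le> \<beta> * (norm f)\<^sup>2" and "0 \<le> \<beta>"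
  shows "K f \<sqsubseteq> \<beta> *\<^sub>R ip f f"
proof (rule cstar_le_epsilon)
  fix e :: real assume e: "e > 0"
  define d where "d = ip f f + e *\<^sub>R 1"
  have ff: "norm_pos (ip f f)" using ip_ge_zero[of f] by (simp add: cstar_le_iff)
  then have "norm_pos d" using e by (simp add: d_def norm_pos_add norm_pos_scaleR_one)
  then obtain s where s: "norm_pos s" "s * s = d" using norm_pos_sqrt by metis
  have "unit_elem (s * s)" using ff e by (simp add: s d_def norm_pos_unit_shift)
  then have "unit_elem s" by (rule unit_elem_factor[rotated]) simp
  then obtain h where h: "s * h = 1" "h * s = 1" by (auto simp: unit_elem_def)
  have ss: "star s = s" using s by (simp add: norm_pos_star)
  have sh: "star h = h" using star_inverse_selfadjoint[OF h ss] .
  define g where "g = act h f"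
  have "ip g g = h * ip f f * h" by (simp add: g_def ip_act_left ip_act_right sh mult.assoc)
  also have "ip f f = s * s - e *\<^sub>R 1" by (simp add: s d_def)
  also have "h * (s * s - e *\<^sub>R 1) * h = (h * s) * (s * h) - e *\<^sub>R (h * h)"
    by (simp add: algebra_simps)
  finally have gg: "ip g g = 1 - e *\<^sub>R (h * h)" by (simp add: h)
  have "0 \<sqsubseteq> e *\<^sub>R (h * star h)"
    using cstar_le_scaleR_mono[OF zero_le_mult_star[of h], of e] e by simp
  then have "ip g g \<sqsubseteq> 1" by (simp add: gg cstar_le_iff sh)
  then have "norm (ip g g) \<le> norm (1::'a)" by (intro cstar_le_norm_mono ip_ge_zero)
  then have "(norm g)\<^sup>2 \<le> 1" using norm_one_le[where 'a='a] by (simp add: norm_ip_self)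
  then have "norm (K g) \<le> \<beta>"
    using bound[of g] mult_left_mono[of "(norm g)\<^sup>2" 1 \<beta>] \<open>0 \<le> \<beta>\<close> by linarith
  moreover have "K g \<sqsubseteq> norm (K g) *\<^sub>R 1" by (intro cstar_le_norm assms)
  ultimately have "K g \<sqsubseteq> \<beta> *\<^sub>R 1"
    using cstar_le_scaleR_left_mono[OF zero_le_one_cstar] cstar_le_trans by blast
  \<comment> \<open>Conjugation by \<open>s\<close> undoes the action of \<open>h\<close>, and
    \<open>s * s = d\<close> yields the bound up to the error \<open>e * \<beta>\<close>.\<close>
  then have "s * K g * star s \<sqsubseteq> s * (\<beta> *\<^sub>R 1) * star s" by (rule cstar_le_conj_mono)
  also have "s * K g * star s = (s * h) * K f * (h * s)"
    by (simp add: g_def assms(2) sh ss mult.assoc)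
  finally show "K f \<sqsubseteq> \<beta> *\<^sub>R ip f f + e *\<^sub>R (\<beta> *\<^sub>R 1)"
    by (simp add: h ss s d_def scaleR_add_right mult.commute)
qed

text \<open>This is \<open>norm_bound_imp_order_bound\<close> for
  \<open>K f = ip (T f) (T f)\<close>.\<close>

lemma bounded_operator_order_bound:
  assumes "bounded_operator act T"
  obtains k where "k > 0" "\<And>x. ip (T x) (T x) \<sqsubseteq> k *\<^sub>R ip x x"
proof -
  have T: "bounded_linear T" "\<And>a x. T (act a x) = act a (T x)"
    using assms by (auto simp: bounded_operator_def)
  obtain k where k: "k > 0" "\<And>x. norm (T x) \<le> norm x * k"
    using bounded_linear.pos_bounded[OF T(1)] by blast
  have "ip (T x) (T x) \<sqsubseteq> k\<^sup>2 *\<^sub>R ip x x" for x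
  proof (rule norm_bound_imp_order_bound)
    fix f
    have "(norm (T f))\<^sup>2 \<le> (norm f * k)\<^sup>2" using k by (intro power_mono) auto
    then show "norm (ip (T f) (T f)) \<le> k\<^sup>2 * (norm f)\<^sup>2"
      by (simp add: norm_ip_self power_mult_distrib mult.commute)
  qed (simp_all add: ip_star T ip_act_left ip_act_right mult.assoc)
  then show ?thesis using k that[of "k\<^sup>2"] by simp
qed

section \<open>Adjoints\<close>

lemma ip_eqI: "(\<And>z. ip x z = ip y z) \<Longrightarrow> x = y"
  using ip_definite[of "x - y"] by (simp add: ip_diff_left)

lemma ip_eqI_right: "(\<And>z. ip z x = ip z y) \<Longrightarrow> x = y"
  using ip_definite[of "x - y"] by (simp add: ip_diff_right)

lemma is_adjoint_sym: "is_adjoint ip T T' \<Longrightarrow> is_adjoint ip T' T"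
  unfolding is_adjoint_def by (metis ip_star)

lemma adjoint_operator_eq: "is_adjoint ip T T' \<Longrightarrow> adjoint_operator ip T = T'"
  unfolding adjoint_operator_def
  by (rule the_equality) (auto simp: is_adjoint_def intro!: ext ip_eqI_right)

lemma bounded_operator_adjoint:
  assumes "bounded_operator act T" "is_adjoint ip T T'"
  shows "bounded_operator act T'"
proof -
  have adj: "ip x (T' y) = ip (T x) y" for x y using assms(2) by (simp add: is_adjoint_def)
  have T: "bounded_linear T" "\<And>a x. T (act a x) = act a (T x)"
    using assms by (auto simp: bounded_operator_def)
  obtain k where k: "k > 0" "\<And>x. norm (T x) \<le> norm x * k"
    using bounded_linear.pos_bounded[OF T(1)] by blast
  have "norm (T' y) \<le> norm y * k" for y
  proof (cases "T' y = 0")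
    case False
    have "(norm (T' y))\<^sup>2 = norm (ip (T (T' y)) y)" by (simp add: adj flip: norm_ip_self)
    also have "\<dots> \<le> (norm (T' y) * k) * norm y"
      by (rule order_trans[OF norm_ip_le]) (intro mult_right_mono k norm_ge_zero)
    finally show ?thesis using False by (simp add: power2_eq_square mult_ac)
  qed (use k in simp)
  then have "bounded_linear T'"
    by (intro bounded_linear_intro[of _ k])
       (auto intro!: ip_eqI_right simp: adj ip_add_right ip_scaleR_right)
  moreover have "T' (act a x) = act a (T' x)" for a x
    by (rule ip_eqI_right) (simp add: adj ip_act_right)
  ultimately show ?thesis by (simp add: bounded_operator_def)
qed

text \<open>For \<open>g = N f\<close> polarization gives
  \<open>4\<langle>g, g\<rangle> = \<langle>N (f + g), f + g\<rangle> - \<langle>N (f - g), f - g\<rangle> \<le> q \<langle>f + g, f + g\<rangle>\<close>.\<close>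

lemma norm_le_of_positive_contraction:
  assumes add: "\<And>x y. N (x + y) = N x + N y" "\<And>x y. N (x - y) = N x - N y"
    and sym: "\<And>x y. ip (N x) y = ip x (N y)"
    and pos: "\<And>x. 0 \<sqsubseteq> ip (N x) x" and le: "\<And>x. ip (N x) x \<sqsubseteq> p\<^sup>2 *\<^sub>R ip x x"
    and p: "0 \<le> p" "p < 1"
  shows "norm (N f) \<le> p / (2 - p) * norm f"
proof -
  define g where "g = N f"
  have "4 *\<^sub>R ip g g = ip (N (f + g)) (f + g) - ip (N (f - g)) (f - g)"
    by (simp add: add ip_add_left ip_add_right ip_diff_left ip_diff_right sym flip: g_def)
       (simp add: g_def sym scaleR_left_distrib[of 2 2, simplified] scaleR_2 add_ac)
  also have "\<dots> \<sqsubseteq> ip (N (f + g)) (f + g)" using pos by (simp add: cstar_le_iff)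
  also have "\<dots> \<sqsubseteq> p\<^sup>2 *\<^sub>R ip (f + g) (f + g)" by (rule le)
  finally have "norm (4 *\<^sub>R ip g g) \<le> norm (p\<^sup>2 *\<^sub>R ip (f + g) (f + g))"
    using cstar_le_scaleR_mono[OF ip_ge_zero[of g], of 4] by (intro cstar_le_norm_mono) simp_all
  then have "(2 * norm g)\<^sup>2 \<le> (p * norm (f + g))\<^sup>2"
    by (simp add: norm_ip_self power_mult_distrib)
  then have "2 * norm g \<le> p * norm (f + g)"
    by (rule power2_le_imp_le) (use p in simp)
  also have "\<dots> \<le> p * (norm f + norm g)" using p by (intro mult_left_mono norm_triangle_ineq)
  \<comment> \<open>Absorbing \<open>norm g\<close> on the left produces the factor
    \<open>p / (2 - p)\<close>, which is below 1.\<close>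
  finally have "(2 - p) * norm g \<le> p * norm f" by (simp add: algebra_simps)
  then show ?thesis using p by (simp add: g_def pos_le_divide_eq mult.commute)
qed

text \<open>No adjoint of \<open>R\<close> is at hand to invert \<open>T'\<close>, so
  \<open>T' (T x) = f\<close> is solved instead. The bounds on \<open>T\<close> and \<open>R\<close>
  make \<open>N = 1 - T' T / k\<close> a contraction, and a fixed point of
  \<open>N x + f / k\<close> is a solution.\<close>

lemma adjoint_surj:
  assumes "bounded_operator act T" "bounded_operator act R" "R \<circ> T = id" "T \<circ> R = id"
    and adj: "is_adjoint ip T T'"
  obtains g where "T' g = f"
proof -
  obtain k0 where k0: "k0 > 0" "\<And>x. ip (T x) (T x) \<sqsubseteq> k0 *\<^sub>R ip x x"
    using bounded_operator_order_bound[OF assms(1)] by blast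
  obtain l0 where l0: "l0 > 0" "\<And>x. ip (R x) (R x) \<sqsubseteq> l0 *\<^sub>R ip x x"
    using bounded_operator_order_bound[OF assms(2)] by blast
  \<comment> \<open>Constants above 1 make \<open>1 - 1 / (k * l)\<close> positive, so that its
    square root \<open>p\<close> lies strictly below 1.\<close>
  define k l where "k = k0 + 1" and "l = l0 + 1"
  have kl: "k > 1" "l > 1" using k0 l0 by (auto simp: k_def l_def)
  have up: "ip (T x) (T x) \<sqsubseteq> k *\<^sub>R ip x x" for x
    using cstar_le_trans[OF k0(2) cstar_le_scaleR_left_mono[OF ip_ge_zero, of k0 k]] by (simp add: k_def)
  have RT: "R (T x) = x" for x using assms(3) by (metis comp_apply id_apply)
  have low: "ip x x \<sqsubseteq> l *\<^sub>R ip (T x) (T x)" for x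
    using cstar_le_trans[OF l0(2) cstar_le_scaleR_left_mono[OF ip_ge_zero, of l0 l], of "T x"]
    by (simp add: RT l_def)
  define N where "N x = x - (1/k) *\<^sub>R T' (T x)" for x
  have lin: "linear T" "linear T'"
    using assms(1) bounded_operator_adjoint[OF assms(1) adj]
    by (simp_all add: bounded_operator_def bounded_linear.linear)
  have adj': "ip (T' x) y = ip x (T y)" "ip x (T' y) = ip (T x) y" for x y
    using adj is_adjoint_sym[OF adj] by (simp_all add: is_adjoint_def)
  have NN: "ip (N x) x = ip x x - (1/k) *\<^sub>R ip (T x) (T x)" for x
    by (simp add: N_def ip_diff_left ip_scaleR_left adj')
  define p where "p = sqrt (1 - 1 / (k * l))"
  have "1 < k * l" using kl less_1_mult by blast
  then have p: "0 \<le> p" "p < 1" "p\<^sup>2 = 1 - 1 / (k * l)" by (auto simp: p_def)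
  have contr: "norm (N x) \<le> p / (2 - p) * norm x" for x
  proof (rule norm_le_of_positive_contraction)
    fix x y
    show "N (x + y) = N x + N y" "N (x - y) = N x - N y"
      by (simp_all add: N_def linear_add[OF lin(1)] linear_add[OF lin(2)] linear_diff[OF lin(1)]
          linear_diff[OF lin(2)] algebra_simps)
    show "ip (N x) y = ip x (N y)"
      by (simp add: N_def ip_diff_left ip_diff_right ip_scaleR_left ip_scaleR_right adj')
    show "0 \<sqsubseteq> ip (N x) x"
      using cstar_le_scaleR_mono[OF up[of x], of "1/k"] kl by (simp add: NN cstar_le_iff)
    have "(1 / (k * l)) *\<^sub>R ip x x \<sqsubseteq> (1/k) *\<^sub>R ip (T x) (T x)"
      using cstar_le_scaleR_mono[OF low[of x], of "1 / (k * l)"] kl by simp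
    then show "ip (N x) x \<sqsubseteq> p\<^sup>2 *\<^sub>R ip x x"
      by (simp add: NN p(3) cstar_le_iff scaleR_diff_left)
  qed (use p in auto)
  have Ndiff: "N x - N y = N (x - y)" for x y
    by (simp add: N_def linear_diff[OF lin(1)] linear_diff[OF lin(2)] algebra_simps)
  have "\<exists>!x. N x + (1/k) *\<^sub>R f = x"
    by (rule banach_fix_type[of "p / (2 - p)"])
       (use p contr in \<open>auto simp: dist_norm Ndiff\<close>)
  then obtain x where "N x + (1/k) *\<^sub>R f = x" by blast
  then have "(1/k) *\<^sub>R f = (1/k) *\<^sub>R T' (T x)" by (simp add: N_def algebra_simps)
  then have "T' (T x) = f" using kl by simp
  then show ?thesis by (rule that)
qed

end

section \<open>Controlled frames\<close>

text \<open>The polarization formula, recovering a form linear in \<open>f\<close> and conjugate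
  linear in \<open>g\<close> from its diagonal \<open>Q\<close>. Subtractions are written as scalar
  multiples so that sum rules and norm estimates apply summand by summand.\<close>

definition polar :: "('h::complex_vector \<Rightarrow> 'a::unital_cstar_algebra) \<Rightarrow> 'h \<Rightarrow> 'h \<Rightarrow> 'a" where
  "polar Q f g = (1/4) *\<^sub>R (Q (f + g) + (-1) *\<^sub>R Q (f - g)
     + \<i> *\<^sub>C Q (f + \<i> *\<^sub>C g) + (- \<i>) *\<^sub>C Q (f - \<i> *\<^sub>C g))"

lemma has_sum_scaleC:
  "(f has_sum s) A \<Longrightarrow> ((\<lambda>x. c *\<^sub>C f x) has_sum c *\<^sub>C (s::'a::unital_cstar_algebra)) A"
  by (rule has_sum_bounded_linear[OF bounded_linear_scaleC])

text \<open>Exchanging \<open>f\<close> and \<open>g\<close> changes the arguments of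
  \<open>Q\<close> only by factors \<open>-1\<close> and \<open>\<i>\<close>, up to the order of the
  summands.\<close>

lemma star_polar:
  assumes "\<And>f. star (Q f) = Q f" "\<And>f. Q (- f) = Q f" "\<And>f. Q (\<i> *\<^sub>C f) = Q f"
  shows "star (polar Q g f) = polar Q f g"
proof -
  have "g + \<i> *\<^sub>C f = \<i> *\<^sub>C (f - \<i> *\<^sub>C g)" "g - \<i> *\<^sub>C f = - (\<i> *\<^sub>C (f + \<i> *\<^sub>C g))"
    by (simp_all add: scaleC_diff_right scaleC_add_right scaleC_scaleC scaleC_minus_left scaleC_one)
  then have "Q (g + \<i> *\<^sub>C f) = Q (f - \<i> *\<^sub>C g)" "Q (g - \<i> *\<^sub>C f) = Q (f + \<i> *\<^sub>C g)"
    by (simp_all only: assms)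
  moreover have "Q (g - f) = Q (f - g)" using assms(2)[of "f - g"] by simp
  ultimately show ?thesis
    by (simp add: polar_def star_scaleR star_add star_scaleC star_diff star_minus assms(1) scaleC_minus_left add_ac)
qed

context hilbert_module
begin

lemma polarization:
  "ip f x * ip y g = polar (\<lambda>f. ip f x * ip y f) f g"
proof -
  have "ip (f + g) x * ip y (f + g) + (-1) *\<^sub>R (ip (f - g) x * ip y (f - g))
     = 2 *\<^sub>R (ip f x * ip y g + ip g x * ip y f)"
    by (simp add: ip_add_left ip_add_right ip_diff_left ip_diff_right scaleR_2 algebra_simps)
  moreover have "\<i> *\<^sub>C (ip (f + \<i> *\<^sub>C g) x * ip y (f + \<i> *\<^sub>C g))
     + (- \<i>) *\<^sub>C (ip (f - \<i> *\<^sub>C g) x * ip y (f - \<i> *\<^sub>C g)) = 2 *\<^sub>R (ip f x * ip y g - ip g x * ip y f)"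
    by (simp add: ip_add_left ip_add_right ip_diff_left ip_diff_right scaleR_2 algebra_simps
        ip_scaleC_left ip_scaleC_right scaleC_mult_left scaleC_mult_right scaleC_scaleC
        scaleC_minus_left scaleC_one scaleC_diff_right scaleC_add_right)
  ultimately show ?thesis
    unfolding polar_def by (simp add: add.assoc flip: scaleR_add_right scaleR_2)
qed

text \<open>Polarizing each term transfers convergence from the diagonal to all pairs.\<close>

lemma polar_has_sum:
  assumes "\<And>f. ((\<lambda>j. ip f (\<psi> j) * ip (\<phi> j) f) has_sum Q f) J"
  shows "((\<lambda>j. ip f (\<psi> j) * ip (\<phi> j) g) has_sum polar Q f g) J"
  by (subst polarization, unfold polar_def)
    (intro has_sum_scaleR has_sum_add has_sum_scaleC assms)

text \<open>All four arguments of \<open>Q\<close> have norm at most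
  \<open>norm f + norm g\<close>.\<close>

lemma norm_polar_le:
  fixes Q :: "'h \<Rightarrow> 'a"
  assumes Q: "\<And>f. norm (Q f) \<le> M * (norm f)\<^sup>2" and "0 \<le> M"
  shows "norm (polar Q f g) \<le> M * (norm f + norm g)\<^sup>2"
proof -
  have *: "norm (Q h) \<le> M * (norm f + norm g)\<^sup>2" if "norm h \<le> norm f + norm g" for h
  proof -
    have "M * (norm h)\<^sup>2 \<le> M * (norm f + norm g)\<^sup>2"
      using that \<open>0 \<le> M\<close> by (intro mult_left_mono power_mono) auto
    then show ?thesis using Q[of h] by linarith
  qed
  have n: "norm (\<i> *\<^sub>C g) = norm g" by (simp add: norm_scaleC_module)
  have "norm (polar Q f g) \<le> (1/4) * (norm (Q (f + g)) + norm (Q (f - g))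
      + norm (Q (f + \<i> *\<^sub>C g)) + norm (Q (f - \<i> *\<^sub>C g)))"
    unfolding polar_def norm_scaleR
    by (intro mult_mono norm_triangle_mono) (simp_all add: norm_scaleC)
  also have "\<dots> \<le> (1/4) * (4 * (M * (norm f + norm g)\<^sup>2))"
    using *[of "f + g"] *[of "f - g"] *[of "f + \<i> *\<^sub>C g"] *[of "f - \<i> *\<^sub>C g"]
      norm_triangle_ineq[of f g] norm_triangle_ineq4[of f g]
      norm_triangle_ineq[of f "\<i> *\<^sub>C g"] norm_triangle_ineq4[of f "\<i> *\<^sub>C g"]
    unfolding n by simp
  finally show ?thesis by simp
qed

text \<open>A finite partial sum \<open>x\<close> obeys \<open>ip x x \<le> \<beta> X\<close> with
  \<open>X\<close> the matching partial frame sum, so small tails of the frame sum force small tails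
  of the vector sum.\<close>

lemma Bessel_summable:
  assumes K: "\<And>f. ((\<lambda>j. ip f (\<psi> j) * ip (\<psi> j) f) has_sum K f) J"
    and le: "\<And>f. K f \<sqsubseteq> \<beta> *\<^sub>R ip f f" and \<beta>: "0 < \<beta>"
  shows "(\<lambda>j. act (ip f (\<psi> j)) (\<psi> j)) summable_on J"
proof (rule summable_on_small_tails)
  have nonneg: "0 \<sqsubseteq> ip f (\<psi> j) * ip (\<psi> j) f" for f j
    using zero_le_mult_star[of "ip f (\<psi> j)"] by (simp add: ip_star)
  have bound: "(norm (\<Sum>j\<in>G. act (ip f (\<psi> j)) (\<psi> j)))\<^sup>2 \<le> \<beta> * norm (\<Sum>j\<in>G. ip f (\<psi> j) * ip (\<psi> j) f)"
    if G: "finite G" "G \<subseteq> J" for G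
  proof -
    define x where "x = (\<Sum>j\<in>G. act (ip f (\<psi> j)) (\<psi> j))"
    define X where "X = (\<Sum>j\<in>G. ip f (\<psi> j) * ip (\<psi> j) f)"
    define t where "t = 1 / \<beta>"
    have t: "0 < t" "t * \<beta> = 1" using \<beta> by (auto simp: t_def)
    \<comment> \<open>Because \<open>x\<close> is itself the partial sum, both mixed sums in the
      expansion at \<open>f - t *\<^sub>R x\<close> equal \<open>ip x x\<close>.\<close>
    have xx: "(\<Sum>j\<in>G. ip f (\<psi> j) * ip (\<psi> j) x) = ip x x"
      by (subst (2) x_def) (simp add: ip_sum_left ip_act_left)
    then have "star (\<Sum>j\<in>G. ip f (\<psi> j) * ip (\<psi> j) x) = ip x x" by (simp add: ip_star)
    then have xx': "(\<Sum>j\<in>G. ip x (\<psi> j) * ip (\<psi> j) f) = ip x x"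
      by (simp add: star_sum star_mult ip_star)
    have "(\<Sum>j\<in>G. ip x (\<psi> j) * ip (\<psi> j) x) \<sqsubseteq> \<beta> *\<^sub>R ip x x"
      using sum_le_has_sum_cstar[OF K nonneg G] le cstar_le_trans by blast
    then have Kx: "(t * t) *\<^sub>R (\<Sum>j\<in>G. ip x (\<psi> j) * ip (\<psi> j) x) \<sqsubseteq> (t * t) *\<^sub>R (\<beta> *\<^sub>R ip x x)"
      by (intro cstar_le_scaleR_mono) auto
    have "0 = (\<Sum>j\<in>G. 0::'a)" by simp
    also have "\<dots> \<sqsubseteq> (\<Sum>j\<in>G. ip (f - t *\<^sub>R x) (\<psi> j) * ip (\<psi> j) (f - t *\<^sub>R x))"
      by (intro cstar_le_sum nonneg)
    also have "\<dots> = X - t *\<^sub>R (\<Sum>j\<in>G. ip f (\<psi> j) * ip (\<psi> j) x) - t *\<^sub>R (\<Sum>j\<in>G. ip x (\<psi> j) * ip (\<psi> j) f)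
        + (t * t) *\<^sub>R (\<Sum>j\<in>G. ip x (\<psi> j) * ip (\<psi> j) x)"
      by (simp add: X_def ip_diff_left ip_diff_right ip_scaleR_left ip_scaleR_right scaleR_sum_right
          left_diff_distrib right_diff_distrib sum.distrib sum_subtractf scaleR_diff_right)
    also have "\<dots> = X - t *\<^sub>R ip x x - t *\<^sub>R ip x x + (t * t) *\<^sub>R (\<Sum>j\<in>G. ip x (\<psi> j) * ip (\<psi> j) x)"
      by (simp only: xx xx')
    also have "\<dots> \<sqsubseteq> X - t *\<^sub>R ip x x - t *\<^sub>R ip x x + (t * t) *\<^sub>R (\<beta> *\<^sub>R ip x x)"
      using Kx by (intro cstar_le_add_mono cstar_le_refl)
    also have "\<dots> = X - t *\<^sub>R ip x x" using t by (simp add: mult.assoc)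
    finally have "t *\<^sub>R ip x x \<sqsubseteq> X" by (simp add: cstar_le_iff)
    then have "\<beta> *\<^sub>R (t *\<^sub>R ip x x) \<sqsubseteq> \<beta> *\<^sub>R X"
      using \<beta> by (intro cstar_le_scaleR_mono) auto
    then have "ip x x \<sqsubseteq> \<beta> *\<^sub>R X" using t by (simp add: mult.commute)
    then have "norm (ip x x) \<le> norm (\<beta> *\<^sub>R X)" by (intro cstar_le_norm_mono ip_ge_zero)
    then show ?thesis using \<beta> by (simp add: norm_ip_self X_def x_def)
  qed
  fix e :: real assume e: "0 < e"
  have "0 < e\<^sup>2 / \<beta>" using e \<beta> by simp
  then obtain F where F: "finite F" "F \<subseteq> J"
    and small: "\<And>G. finite G \<Longrightarrow> G \<subseteq> J - F \<Longrightarrow> norm (\<Sum>j\<in>G. ip f (\<psi> j) * ip (\<psi> j) f) < e\<^sup>2 / \<beta>"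
    using has_sum_small_tails[OF K] by metis
  have "norm (\<Sum>j\<in>G. act (ip f (\<psi> j)) (\<psi> j)) < e" if "finite G" "G \<subseteq> J - F" for G
  proof (rule power2_less_imp_less)
    have "G \<subseteq> J" using that by blast
    note bound[OF that(1) this]
    also have "\<beta> * norm (\<Sum>j\<in>G. ip f (\<psi> j) * ip (\<psi> j) f) < \<beta> * (e\<^sup>2 / \<beta>)"
      using small[OF that] \<beta> by (rule mult_strict_left_mono)
    finally show "(norm (\<Sum>j\<in>G. act (ip f (\<psi> j)) (\<psi> j)))\<^sup>2 < e\<^sup>2" using \<beta> by simp
  qed (use e in simp)
  with F show "\<exists>F. finite F \<and> F \<subseteq> J \<and>
      (\<forall>G. finite G \<longrightarrow> G \<subseteq> J - F \<longrightarrow> norm (\<Sum>j\<in>G. act (ip f (\<psi> j)) (\<psi> j)) < e)"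
    by blast
qed

text \<open>As \<open>C\<^sup>*\<close> is onto, every \<open>f\<close> is \<open>C\<^sup>* g\<close>, and the frame sum at \<open>f\<close> is the polarized controlled
  sum \<open>\<Sum>\<^sub>j \<langle>f, \<psi>\<^sub>j\<rangle>\<langle>C \<psi>\<^sub>j, g\<rangle>\<close>; this bypasses the controlled frame operator.\<close>

lemma frame_sum_bounded:
  assumes C: "C \<in> GL act" and adj: "is_adjoint ip C C'"
    and Q: "\<And>f. ((\<lambda>j. ip f (\<psi> j) * ip (C (\<psi> j)) f) has_sum Q f) J"
    and Q_le: "\<And>f. norm (Q f) \<le> M * (norm f)\<^sup>2" and M: "0 \<le> M"
  obtains K \<beta> where "\<And>f. ((\<lambda>j. ip f (\<psi> j) * ip (\<psi> j) f) has_sum K f) J"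
    "\<And>f. K f \<sqsubseteq> \<beta> *\<^sub>R ip f f" "0 < \<beta>"
proof -
  obtain R where R: "bounded_operator act C" "bounded_operator act R" "R \<circ> C = id" "C \<circ> R = id"
    using C by (auto simp: GL_def)
  obtain r where r: "r > 0" "\<And>x. norm (R x) \<le> norm x * r"
    using R(2) bounded_linear.pos_bounded unfolding bounded_operator_def by blast
  have CR: "C (R x) = x" for x using R(4) by (metis comp_apply id_apply)
  have adj': "ip (C x) y = ip x (C' y)" for x y using adj by (simp add: is_adjoint_def)
  have ex: "\<exists>g. C' g = f \<and> norm g \<le> r * norm f" for f
  proof -
    obtain g where g: "C' g = f" using adjoint_surj[OF R adj] by blast
    \<comment> \<open>Writing \<open>g = C (R g)\<close> and moving \<open>C\<close> across replaces
      the other \<open>g\<close> by \<open>f\<close>.\<close>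
    have "(norm g)\<^sup>2 = norm (ip (C (R g)) g)" by (simp add: CR norm_ip_self)
    also have "\<dots> = norm (ip (R g) f)" by (simp add: adj' g)
    also have "\<dots> \<le> (norm g * r) * norm f"
      by (rule order_trans[OF norm_ip_le]) (intro mult_right_mono r norm_ge_zero)
    finally have "norm g \<le> r * norm f"
      using r by (cases "norm g = 0") (simp_all add: power2_eq_square mult_ac)
    with g show ?thesis by blast
  qed
  define K where "K f = (\<Sum>\<^sub>\<infinity>j\<in>J. ip f (\<psi> j) * ip (\<psi> j) f)" for f
  have K: "((\<lambda>j. ip f (\<psi> j) * ip (\<psi> j) f) has_sum K f) J \<and> norm (K f) \<le> M * (1 + r)\<^sup>2 * (norm f)\<^sup>2" for f
  proof -
    obtain g where g: "C' g = f" "norm g \<le> r * norm f" using ex by blast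
    have hs: "((\<lambda>j. ip f (\<psi> j) * ip (\<psi> j) f) has_sum polar Q f g) J"
      using polar_has_sum[OF Q, of f g] by (simp add: adj' g)
    have "M * (norm f + norm g)\<^sup>2 \<le> M * ((1 + r) * norm f)\<^sup>2"
      using g M by (intro mult_left_mono power_mono) (simp_all add: algebra_simps)
    then have "norm (polar Q f g) \<le> M * (1 + r)\<^sup>2 * (norm f)\<^sup>2"
      using norm_polar_le[OF Q_le M, of f g] by (simp add: power_mult_distrib mult.assoc)
    moreover have "K f = polar Q f g" unfolding K_def using hs by (rule infsumI)
    ultimately show ?thesis using hs by simp
  qed
  \<comment> \<open>The summand 1 keeps \<open>\<beta>\<close> positive when
    \<open>M = 0\<close>.\<close>
  define \<beta> where "\<beta> = M * (1 + r)\<^sup>2 + 1"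
  have "K f \<sqsubseteq> \<beta> *\<^sub>R ip f f" for f
  proof (rule norm_bound_imp_order_bound)
    fix f
    have "((\<lambda>j. star (ip f (\<psi> j) * ip (\<psi> j) f)) has_sum star (K f)) J"
      using K by (intro has_sum_bounded_linear[OF bounded_linear_star]) blast
    then have "((\<lambda>j. ip f (\<psi> j) * ip (\<psi> j) f) has_sum star (K f)) J"
      by (simp add: star_mult ip_star)
    then show "star (K f) = K f" using K has_sum_unique by blast
    have "M * (1 + r)\<^sup>2 * (norm f)\<^sup>2 \<le> \<beta> * (norm f)\<^sup>2"
      by (intro mult_right_mono) (simp_all add: \<beta>_def)
    then show "norm (K f) \<le> \<beta> * (norm f)\<^sup>2" using K[of f] by linarith
    fix a :: 'a
    have "bounded_linear (\<lambda>x. a * x * star a)"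
      using bounded_linear_compose[OF bounded_linear_mult_left bounded_linear_mult_right] .
    then have "((\<lambda>j. a * (ip f (\<psi> j) * ip (\<psi> j) f) * star a) has_sum a * K f * star a) J"
      by (rule has_sum_bounded_linear[OF _ K[THEN conjunct1]])
    then show "K (act a f) = a * K f * star a"
      unfolding K_def[of "act a f"] by (intro infsumI) (simp add: ip_act_left ip_act_right mult.assoc)
  qed (use M in \<open>simp add: \<beta>_def\<close>)
  moreover have "0 < \<beta>" using M by (simp add: \<beta>_def add_nonneg_pos)
  ultimately show ?thesis by (rule that[OF K[THEN conjunct1]])
qed

text \<open>Since \<open>0 \<le> \<Sum>\<^sub>j \<langle>f - tC\<^sup>*f, \<psi>\<^sub>j\<rangle>\<langle>\<psi>\<^sub>j, f - tC\<^sup>*f\<rangle> = K f - 2 t Q f + t\<^sup>2 K (C\<^sup>*f)\<close>, a suitable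
  small \<open>t\<close> transfers the lower bound of \<open>Q\<close> to \<open>K\<close>.\<close>

lemma frame_sum_lower_bound:
  assumes C: "bounded_operator act C" and adj: "is_adjoint ip C C'"
    and Q: "\<And>f. ((\<lambda>j. ip f (\<psi> j) * ip (C (\<psi> j)) f) has_sum Q f) J"
    and Q_ge: "\<And>f. m *\<^sub>R ip f f \<sqsubseteq> Q f" and m: "0 < m"
    and K: "\<And>f. ((\<lambda>j. ip f (\<psi> j) * ip (\<psi> j) f) has_sum K f) J"
    and K_le: "\<And>f. K f \<sqsubseteq> \<beta> *\<^sub>R ip f f" and \<beta>: "0 < \<beta>"
  obtains \<alpha> where "0 < \<alpha>" "\<And>f. \<alpha> *\<^sub>R ip f f \<sqsubseteq> K f"
proof -
  obtain k where k: "k > 0" "\<And>f. ip (C' f) (C' f) \<sqsubseteq> k *\<^sub>R ip f f"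
    using bounded_operator_order_bound[OF bounded_operator_adjoint[OF C adj]] by blast
  have adj': "ip (C x) y = ip x (C' y)" "ip x (C y) = ip (C' x) y" for x y
    using adj is_adjoint_sym[OF adj] by (simp_all add: is_adjoint_def)
  \<comment> \<open>This choice gives \<open>t\<^sup>2 \<beta> k = t m\<close>, half of the
    \<open>2 t m\<close> contributed by \<open>Q\<close>.\<close>
  define t where "t = m / (\<beta> * k)"
  have t: "t > 0" using m \<beta> k by (simp add: t_def)
  have "(t * m) *\<^sub>R ip f f \<sqsubseteq> K f" for f
  proof -
    have nn: "0 \<sqsubseteq> m *\<^sub>R ip f f" using cstar_le_scaleR_mono[OF ip_ge_zero, of m] m by simp
    then have "star (Q f) = Q f"
      using cstar_le_trans[OF nn Q_ge] by (simp add: cstar_le_iff norm_pos_star)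
    \<comment> \<open>The star of the controlled sum is the other mixed sum; self-adjointness of
      \<open>Q f\<close> gives both the same value.\<close>
    then have Q': "((\<lambda>j. ip (C' f) (\<psi> j) * ip (\<psi> j) f) has_sum Q f) J"
      using has_sum_bounded_linear[OF bounded_linear_star Q, of f]
      by (simp add: star_mult ip_star adj')
    have "((\<lambda>j. ip f (\<psi> j) * ip (\<psi> j) f + (- t) *\<^sub>R (ip f (\<psi> j) * ip (C (\<psi> j)) f)
        + (- t) *\<^sub>R (ip (C' f) (\<psi> j) * ip (\<psi> j) f) + t\<^sup>2 *\<^sub>R (ip (C' f) (\<psi> j) * ip (\<psi> j) (C' f)))
        has_sum (K f + (- t) *\<^sub>R Q f + (- t) *\<^sub>R Q f + t\<^sup>2 *\<^sub>R K (C' f))) J"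
      by (intro has_sum_add has_sum_scaleR K Q Q')
    moreover have "0 \<sqsubseteq> ip f (\<psi> j) * ip (\<psi> j) f + (- t) *\<^sub>R (ip f (\<psi> j) * ip (C (\<psi> j)) f)
        + (- t) *\<^sub>R (ip (C' f) (\<psi> j) * ip (\<psi> j) f) + t\<^sup>2 *\<^sub>R (ip (C' f) (\<psi> j) * ip (\<psi> j) (C' f))" for j
    proof -
      have "0 \<sqsubseteq> ip (f - t *\<^sub>R C' f) (\<psi> j) * ip (\<psi> j) (f - t *\<^sub>R C' f)"
        using zero_le_mult_star[of "ip (f - t *\<^sub>R C' f) (\<psi> j)"] by (simp add: ip_star)
      then show ?thesis
        by (simp add: ip_diff_left ip_diff_right ip_scaleR_left ip_scaleR_right adj'
            algebra_simps power2_eq_square)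
    qed
    ultimately have "0 \<sqsubseteq> K f + (- t) *\<^sub>R Q f + (- t) *\<^sub>R Q f + t\<^sup>2 *\<^sub>R K (C' f)"
      by (intro cstar_le_has_sum[OF has_sum_0]) auto
    then have "2 *\<^sub>R t *\<^sub>R Q f \<sqsubseteq> K f + t\<^sup>2 *\<^sub>R K (C' f)"
      unfolding scaleR_2 by (simp add: cstar_le_iff algebra_simps)
    moreover have "2 *\<^sub>R t *\<^sub>R m *\<^sub>R ip f f \<sqsubseteq> 2 *\<^sub>R t *\<^sub>R Q f"
      using t by (intro cstar_le_scaleR_mono Q_ge) auto
    moreover have "K f + t\<^sup>2 *\<^sub>R K (C' f) \<sqsubseteq> K f + t\<^sup>2 *\<^sub>R (\<beta> *\<^sub>R (k *\<^sub>R ip f f))"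
    proof -
      have "K (C' f) \<sqsubseteq> \<beta> *\<^sub>R (k *\<^sub>R ip f f)"
        using cstar_le_trans[OF K_le cstar_le_scaleR_mono[OF k(2)]] \<beta> by simp
      then show ?thesis by (intro cstar_le_add_mono cstar_le_refl cstar_le_scaleR_mono) auto
    qed
    moreover have "t\<^sup>2 *\<^sub>R (\<beta> *\<^sub>R (k *\<^sub>R ip f f)) = (t * m) *\<^sub>R ip f f"
      using m \<beta> k by (simp add: t_def power2_eq_square)
    ultimately have "2 *\<^sub>R t *\<^sub>R m *\<^sub>R ip f f \<sqsubseteq> K f + (t * m) *\<^sub>R ip f f"
      using cstar_le_trans by metis
    then show ?thesis by (simp only: cstar_le_iff scaleR_2) (simp add: algebra_simps)
  qed
  then show ?thesis by (rule that[rotated]) (use t m in simp)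
qed

end

theorem proposition3p10:
  fixes act :: "'a::unital_cstar_algebra \<Rightarrow> 'h::{complex_vector,banach} \<Rightarrow> 'h"
    and ip :: "'h \<Rightarrow> 'h \<Rightarrow> 'a"
    and C :: "'h \<Rightarrow> 'h"
    and J :: "'j set"
    and \<psi> :: "'j \<Rightarrow> 'h"
  assumes "hilbert_module act ip"
    and "finitely_generated act \<or> countably_generated act"
    and "C \<in> GL act"
    and "adjointable ip C"
    and "countable J"
    and "controlled_frame ip C J \<psi>"
  shows "frame ip J \<psi> \<and>
    (\<forall>f. (\<lambda>j. act (ip f (\<psi> j)) (\<psi> j)) summable_on J) \<and>
    C \<circ> frame_operator act ip J \<psi> = frame_operator act ip J \<psi> \<circ> adjoint_operator ip C \<and>
    (\<forall>f. (\<lambda>j. act (ip f (\<psi> j)) (C (\<psi> j))) summable_on J \<and>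
         (\<lambda>j. act (ip f (C (\<psi> j))) (\<psi> j)) summable_on J \<and>
         (\<Sum>\<^sub>\<infinity>j\<in>J. act (ip f (\<psi> j)) (C (\<psi> j))) =
         (\<Sum>\<^sub>\<infinity>j\<in>J. act (ip f (C (\<psi> j))) (\<psi> j)))"
proof -
  interpret hilbert_module act ip by fact
  obtain C' where adj: "is_adjoint ip C C'" using assms(4) by (auto simp: adjointable_def)
  have adj': "ip (C x) y = ip x (C' y)" "ip x (C y) = ip (C' x) y" for x y
    using adj is_adjoint_sym[OF adj] by (simp_all add: is_adjoint_def)
  have C: "bounded_operator act C" using assms(3) by (simp add: GL_def)
  have C_lin: "bounded_linear C" and C_act: "C (act a x) = act a (C x)" for a x
    using C by (simp_all add: bounded_operator_def)
  define Q where "Q f = (\<Sum>\<^sub>\<infinity>j\<in>J. ip f (\<psi> j) * ip (C (\<psi> j)) f)" for f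
  obtain m M :: real where m: "m > 0"
    and sm: "\<And>f. (\<lambda>j. ip f (\<psi> j) * ip (C (\<psi> j)) f) summable_on J"
    and Q_ge: "\<And>f. m *\<^sub>R ip f f \<sqsubseteq> Q f" and Q_le: "\<And>f. Q f \<sqsubseteq> M *\<^sub>R ip f f"
    using assms(6) unfolding controlled_frame_def Q_def by blast
  have Q: "((\<lambda>j. ip f (\<psi> j) * ip (C (\<psi> j)) f) has_sum Q f) J" for f
    unfolding Q_def by (rule has_sum_infsum[OF sm])
  have Q_pos: "0 \<sqsubseteq> Q f" for f
    using cstar_le_trans[OF cstar_le_scaleR_mono[OF ip_ge_zero, of m] Q_ge] m by simp
  \<comment> \<open>The sign of \<open>M\<close> is not prescribed, hence the absolute
    value.\<close>
  have "norm (Q f) \<le> \<bar>M\<bar> * (norm f)\<^sup>2" for f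
    using cstar_le_norm_mono[OF Q_pos Q_le, of f] by (simp add: norm_ip_self)
  then obtain K \<beta> where K: "\<And>f. ((\<lambda>j. ip f (\<psi> j) * ip (\<psi> j) f) has_sum K f) J"
    and K_le: "\<And>f. K f \<sqsubseteq> \<beta> *\<^sub>R ip f f" and \<beta>: "0 < \<beta>"
    using frame_sum_bounded[OF assms(3) adj Q, of "\<bar>M\<bar>"] by auto
  obtain \<alpha> where \<alpha>: "0 < \<alpha>" "\<And>f. \<alpha> *\<^sub>R ip f f \<sqsubseteq> K f"
    using frame_sum_lower_bound[OF C adj Q Q_ge m K K_le \<beta>] by blast
  have fr: "frame ip J \<psi>"
    unfolding frame_def
  proof (intro exI conjI allI)
    fix f
    show "(\<lambda>j. ip f (\<psi> j) * ip (\<psi> j) f) summable_on J" using K summable_on_def by blast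
    show "\<alpha> *\<^sub>R ip f f \<sqsubseteq> (\<Sum>\<^sub>\<infinity>j\<in>J. ip f (\<psi> j) * ip (\<psi> j) f)" by (simp add: infsumI[OF K] \<alpha>)
    show "(\<Sum>\<^sub>\<infinity>j\<in>J. ip f (\<psi> j) * ip (\<psi> j) f) \<sqsubseteq> \<beta> *\<^sub>R ip f f" by (simp add: infsumI[OF K] K_le)
  qed (fact \<alpha> \<beta>)+
  define S where "S = frame_operator act ip J \<psi>"
  have sum: "(\<lambda>j. act (ip f (\<psi> j)) (\<psi> j)) summable_on J" for f
    by (rule Bessel_summable[OF K K_le \<beta>])
  have S: "((\<lambda>j. act (ip f (\<psi> j)) (\<psi> j)) has_sum S f) J" for f
    unfolding S_def frame_operator_def by (rule has_sum_infsum[OF sum])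
  have CS: "((\<lambda>j. act (ip f (\<psi> j)) (C (\<psi> j))) has_sum C (S f)) J" for f
    using has_sum_bounded_linear[OF C_lin S] by (simp add: C_act)
  have SC: "((\<lambda>j. act (ip f (C (\<psi> j))) (\<psi> j)) has_sum S (C' f)) J" for f
    using S[of "C' f"] by (simp add: adj')
  \<comment> \<open>Paired with \<open>g\<close>, the left side is \<open>polar Q f g\<close> and
    the right side \<open>star (polar Q g f)\<close>; they agree because \<open>Q\<close> is
    self-adjoint.\<close>
  have "C (S f) = S (C' f)" for f
  proof (rule ip_eqI)
    fix g
    have "((\<lambda>j. ip f (\<psi> j) * ip (C (\<psi> j)) g) has_sum ip (C (S f)) g) J"
      using has_sum_bounded_linear[OF bounded_linear_ip_left CS] by (simp add: ip_act_left)
    then have "ip (C (S f)) g = polar Q f g" using polar_has_sum[OF Q] has_sum_unique by blast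
    also have "\<dots> = star (polar Q g f)"
    proof (rule star_polar[symmetric])
      fix f
      show "star (Q f) = Q f" using Q_pos[of f] by (simp add: cstar_le_iff norm_pos_star)
      show "Q (- f) = Q f"
        using ip_scaleR_left[of "-1" f] ip_scaleR_right[of _ "-1" f] by (simp add: Q_def)
      show "Q (\<i> *\<^sub>C f) = Q f"
        by (simp add: Q_def ip_scaleC_left ip_scaleC_right scaleC_mult_left scaleC_mult_right
            scaleC_scaleC scaleC_one)
    qed
    also have "\<dots> = ip (S (C' f)) g"
    proof -
      have "((\<lambda>j. ip f (C (\<psi> j)) * ip (\<psi> j) g) has_sum star (polar Q g f)) J"
        using has_sum_bounded_linear[OF bounded_linear_star polar_has_sum[OF Q, of g f]]
        by (simp add: star_mult ip_star)
      moreover have "((\<lambda>j. ip f (C (\<psi> j)) * ip (\<psi> j) g) has_sum ip (S (C' f)) g) J"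
        using has_sum_bounded_linear[OF bounded_linear_ip_left SC] by (simp add: ip_act_left)
      ultimately show ?thesis using has_sum_unique by blast
    qed
    finally show "ip (C (S f)) g = ip (S (C' f)) g" .
  qed
  then have eq: "C \<circ> S = S \<circ> C'" by auto
  have "(\<lambda>j. act (ip f (\<psi> j)) (C (\<psi> j))) summable_on J"
    "(\<lambda>j. act (ip f (C (\<psi> j))) (\<psi> j)) summable_on J" for f
    using CS SC summable_on_def by blast+
  moreover have "(\<Sum>\<^sub>\<infinity>j\<in>J. act (ip f (\<psi> j)) (C (\<psi> j))) = (\<Sum>\<^sub>\<infinity>j\<in>J. act (ip f (C (\<psi> j))) (\<psi> j))" for f
    using infsumI[OF CS] infsumI[OF SC] fun_cong[OF eq, of f] by simp
  ultimately show ?thesis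
    using fr sum eq by (simp add: adjoint_operator_eq[OF adj] S_def)
qed

end
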